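(* Let $\boldsymbol K=([0,1],\oplus,\otimes)$ be the 2-monoid with $p_1\otimes p_2=p_1p_2$ and $p_1\oplus p_2=1-(1-p_1)(1-p_2)$ (identities $\boldsymbol 0=0$ and $\boldsymbol 1=1$). Let $Q$ be a fixed hierarchical self-join-free Boolean conjunctive query and let $\mathcal D$ be a tuple-independent probabilistic database for $Q$, viewed as a $\boldsymbol K$-annotated database instance in which each fact is annotated with its probability. Then, using $Q$ and $\mathcal D$ as inputs, the Hierarchical Elimination Algorithm runs in time $O(|\mathcal D|)$ and outputs the probability that $Q$ evaluates to true over all possible worlds of $\mathcal D$.
   Context: **Queries and databases.** An atom is $R(\boldsymbol X)$ with $R$ a relation symbol and $\boldsymbol X$ a finite set of variables. A self-join-free Boolean conjunctive query (SJF-BCQ) is $Q() \text{ :- } \bigwedge_{R(\boldsymbol X)\in \mathsf{at}(Q)} R(\boldsymbol X)$, with $\mathsf{at}(Q)$ a finite nonempty set of atoms with pairwise distinct relation symbols; $\mathsf{vars}(Q)$ is its set of variables and $\mathsf{at}(Y)$ is the set of atoms of $Q$ containing the variable $Y$. $Q$ is hierarchical if for all $X,Y\in\mathsf{vars}(Q)$: $\mathsf{at}(X)\subseteq\mathsf{at}(Y)$, or $\mathsf{at}(Y)\subseteq\mathsf{at}(X)$, or $\mathsf{at}(X)\cap\mathsf{at}(Y)=\emptyset$. $\mathsf{Dom}$ is a countably infinite domain; $\mathsf{Dom}^{\boldsymbol X}$ is the set of functions $\boldsymbol X\to\mathsf{Dom}$. A fact is $R(\boldsymbol x)$ with $R(\boldsymbol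 X)\in\mathsf{at}(Q)$, $\boldsymbol x\in\mathsf{Dom}^{\boldsymbol X}$. A database instance for $Q$ is a finite set of facts; $|\mathcal D|$ is its number of facts. $Q$ is true on a database $\mathcal D'$ if there is $\boldsymbol w\in\mathsf{Dom}^{\mathsf{vars}(Q)}$ with $R(\boldsymbol w|_{\boldsymbol X})\in\mathcal D'$ for all $R(\boldsymbol X)\in\mathsf{at}(Q)$. **Tuple-independent probabilistic database.** A database instance $\mathcal D$ in which each fact $f$ has a probability $p_f\in[0,1]$. A possible world is a random subset $\mathcal D'\subseteq\mathcal D$ obtained by keeping each fact $f$ independently with probability $p_f$. The probability of $Q$ is the probability that $Q$ is true on $\mathcal D'$. Facts not in $\mathcal D$ have probability (annotation) $0$. **2-monoids and annotations.** A 2-monoid $\boldsymbol K=(K,\oplus,\otimes)$ consists of two commutative monoids $(K,\oplus)$ with identity $\boldsymbol 0$ and $(K,\otimes)$ with identity $\boldsymbol 1$ such that $\boldsymbol 0\otimes\boldsymbol 0=\boldsymbol 0$. A $\boldsymbol K$-annotated relation $R(\boldsymbol X)$ assigns to each $\boldsymbol x\in\mathsf{Dom}^{\boldsymbol X}$ an annotation $R(\boldsymbol x)\in K$, all but finitely many equal to $\boldsymbol 0$; only the facts with annotation $\ne\boldsymbol 0$ are stored. A $\boldsymbol K$-annotated database instance for $Q$ consists of one such relation for each atom of $Q$. **Hierarchical Elimination Algorithm** (parameter: a 2-monoid $\boldsymbol K$; input: a hierarchical SJF-BCQ $Q$ and a $\boldsymbol K$-annotated database instance). While $Q$ is not of the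 form $Q()\text{ :- }R()$: (Rule 1) if some variable $Y$ occurs in only one atom $R(\boldsymbol X)$, let $\boldsymbol X'=\boldsymbol X\setminus\{Y\}$ and replace $R(\boldsymbol X)$ by a new atom $R'(\boldsymbol X')$ annotated by $R'(\boldsymbol x')=\bigoplus_{y\in\mathsf{Dom}}R(\boldsymbol x',y)$ for all $\boldsymbol x'\in\mathsf{Dom}^{\boldsymbol X'}$; (Rule 2) else if there are two distinct atoms $R_1(\boldsymbol X),R_2(\boldsymbol X)$ with the same variable set, replace both by a single new atom $R'(\boldsymbol X)$ annotated by $R'(\boldsymbol x)=R_1(\boldsymbol x)\otimes R_2(\boldsymbol x)$ for all $\boldsymbol x\in\mathsf{Dom}^{\boldsymbol X}$; else report that $Q$ is not hierarchical. At the end return the annotation $R()\in K$ of the empty tuple. **Complexity conventions.** Data complexity: $Q$ is fixed and constants may depend on $Q$. Each $\oplus$ and $\otimes$ operation on probabilities takes constant time. Inside $O(\cdot)$, sizes are read as at least $1$. *)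

theory Defs
  imports
    "HOL-Probability.Product_PMF"
    "HOL-Algebra.Ring"
    "HOL-Library.AList"
    "HOL-Library.Monad_Syntax"
    "HOL-Library.Countable"
    "HOL-Library.Infinite_Typeclass"
begin

type_synonym ('r, 'v) atom = "'r \<times> 'v set"
type_synonym ('r, 'v) query = "('r, 'v) atom set"

definition sjf_bcq :: "('r, 'v) query \<Rightarrow> bool" where
  "sjf_bcq Q \<longleftrightarrow> finite Q \<and> Q \<noteq> {} \<and> (\<forall>(R, X)\<in>Q. finite X) \<and> inj_on fst Q"

definition vars :: "('r, 'v) query \<Rightarrow> 'v set" where
  "vars Q = (\<Union>(R, X)\<in>Q. X)"

definition atoms_with :: "('r, 'v) query \<Rightarrow> 'v \<Rightarrow> ('r, 'v) query" where
  "atoms_with Q Y = {(R, X) \<in> Q. Y \<in> X}"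

definition hierarchical :: "('r, 'v) query \<Rightarrow> bool" where
  "hierarchical Q \<longleftrightarrow> (\<forall>X\<in>vars Q. \<forall>Y\<in>vars Q.
     atoms_with Q X \<subseteq> atoms_with Q Y \<or> atoms_with Q Y \<subseteq> atoms_with Q X \<or>
     atoms_with Q X \<inter> atoms_with Q Y = {})"

text \<open>A tuple over \<open>X\<close> is a function on \<open>X\<close>, represented as usual by a function that is
  \<open>undefined\<close> outside \<open>X\<close>; the only tuple over \<open>{}\<close> is \<open>\<lambda>_. undefined\<close>.\<close>

type_synonym ('v, 'd) tuple = "'v \<Rightarrow> 'd"
type_synonym ('r, 'v, 'd) fact = "'r \<times> ('v, 'd) tuple"

definition tuples :: "'v set \<Rightarrow> ('v, 'd) tuple set" where
  "tuples X = X \<rightarrow>\<^sub>E UNIV"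

definition facts :: "('r, 'v) query \<Rightarrow> ('r, 'v, 'd) fact set" where
  "facts Q = {(R, x) | R x. \<exists>X. (R, X) \<in> Q \<and> x \<in> tuples X}"

definition db_instance :: "('r, 'v) query \<Rightarrow> ('r, 'v, 'd) fact set \<Rightarrow> bool" where
  "db_instance Q D \<longleftrightarrow> finite D \<and> D \<subseteq> facts Q"

definition query_true :: "('r, 'v) query \<Rightarrow> ('r, 'v, 'd) fact set \<Rightarrow> bool" where
  "query_true Q D \<longleftrightarrow> (\<exists>w\<in>tuples (vars Q). \<forall>(R, X)\<in>Q. (R, restrict w X) \<in> D)"

definition prob_db ::
  "('r, 'v) query \<Rightarrow> ('r, 'v, 'd) fact set \<Rightarrow> (('r, 'v, 'd) fact \<Rightarrow> real) \<Rightarrow> bool" where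
  "prob_db Q D p \<longleftrightarrow> db_instance Q D \<and> (\<forall>f\<in>D. 0 \<le> p f \<and> p f \<le> 1)"

definition possible_world :: "'f set \<Rightarrow> ('f \<Rightarrow> real) \<Rightarrow> 'f set pmf" where
  "possible_world D p =
     map_pmf (\<lambda>b. {f \<in> D. b f}) (Pi_pmf D False (\<lambda>f. bernoulli_pmf (p f)))"

definition query_prob ::
  "('r, 'v) query \<Rightarrow> ('r, 'v, 'd) fact set \<Rightarrow> (('r, 'v, 'd) fact \<Rightarrow> real) \<Rightarrow> real" where
  "query_prob Q D p = measure_pmf.prob (possible_world D p) {W. query_true Q W}"

text \<open>2-monoids reuse the records of rings; no inverses and no distributivity are required.\<close>

locale two_monoid = abelian_monoid K + comm_monoid K for K (structure) +
  assumes zero_mult_zero: "\<zero> \<otimes> \<zero> = \<zero>"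

definition prob_monoid :: "real ring" where
  "prob_monoid = \<lparr>carrier = {0..1}, mult = (\<lambda>p q. p * q), one = 1,
     zero = 0, add = (\<lambda>p q. 1 - (1 - p) * (1 - q))\<rparr>"

lemma two_monoid_prob_monoid: "two_monoid prob_monoid"
proof -
  have le: "x * y \<le> x + y" "x + y \<le> 1 + x * y"
    if "0 \<le> x" "x \<le> 1" "0 \<le> y" "y \<le> 1" for x y :: real
  proof -
    have "0 \<le> (1 - x) * (1 - y)" "(1 - x) * (1 - y) \<le> 1"
      using that by (auto intro!: mult_nonneg_nonneg mult_le_one)
    then show "x * y \<le> x + y" "x + y \<le> 1 + x * y" by (auto simp: algebra_simps)
  qed
  show ?thesis
    by unfold_locales
      (auto simp: prob_monoid_def algebra_simps intro: mult_le_one le)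
qed

type_synonym ('v, 'd, 'k) rel = "('v, 'd) tuple \<Rightarrow> 'k"
type_synonym ('r, 'v, 'd, 'k) adb = "'r \<Rightarrow> ('v, 'd, 'k) rel"

text \<open>The values of a relation over \<open>X\<close> outside \<open>tuples X\<close>, and those of relation symbols
  that do not occur in the query, are irrelevant.\<close>

definition annotated_relation ::
  "('k, 'm) ring_scheme \<Rightarrow> 'v set \<Rightarrow> ('v, 'd, 'k) rel \<Rightarrow> bool" where
  "annotated_relation K X r \<longleftrightarrow>
     (\<forall>x\<in>tuples X. r x \<in> carrier K) \<and> finite {x \<in> tuples X. r x \<noteq> \<zero>\<^bsub>K\<^esub>}"

definition annotated_instance ::
  "('k, 'm) ring_scheme \<Rightarrow> ('r, 'v) query \<Rightarrow> ('r, 'v, 'd, 'k) adb \<Rightarrow> bool" where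
  "annotated_instance K Q A \<longleftrightarrow> (\<forall>(R, X)\<in>Q. annotated_relation K X (A R))"

definition prob_annotation ::
  "('r, 'v, 'd) fact set \<Rightarrow> (('r, 'v, 'd) fact \<Rightarrow> real) \<Rightarrow> ('r, 'v, 'd, real) adb" where
  "prob_annotation D p = (\<lambda>R x. if (R, x) \<in> D then p (R, x) else 0)"

lemma annotated_instance_prob_annotation:
  assumes "prob_db Q D p"
  shows "annotated_instance prob_monoid Q (prob_annotation D p)"
proof -
  have fin: "finite D" and p: "\<And>f. f \<in> D \<Longrightarrow> 0 \<le> p f \<and> p f \<le> 1"
    using assms by (auto simp: prob_db_def db_instance_def)
  have "finite {x \<in> tuples X. (if (R, x) \<in> D then p (R, x) else 0) \<noteq> 0}" for R X
    by (rule finite_subset[of _ "snd ` D"]) (use fin in \<open>force split: if_splits\<close>)+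
  then show ?thesis
    using p by (auto simp: annotated_instance_def annotated_relation_def prob_annotation_def
        prob_monoid_def split: if_splits)
qed

definition stores ::
  "('k, 'm) ring_scheme \<Rightarrow> 'v set \<Rightarrow> ('v, 'd, 'k) rel \<Rightarrow> (('v, 'd) tuple \<times> 'k) list \<Rightarrow> bool"
  where
  "stores K X r L \<longleftrightarrow> distinct (map fst L) \<and>
     set L = {(x, r x) | x. x \<in> tuples X \<and> r x \<noteq> \<zero>\<^bsub>K\<^esub>}"

text \<open>Running time is the number of ticks of programs in the following monad. The machine is a
  unit-cost RAM with constant-time tables: one tick pays for fetching a list cell,
  for one \<open>\<oplus>\<close>, one \<open>\<otimes>\<close> or one test for \<open>\<zero>\<close>; a projection to a
  tuple over \<open>X\<close> and an access to a table whose keys are tuples over \<open>X\<close> take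
  \<open>1 + card X\<close> ticks. Tables are modelled by association lists, of which only the extensional
  content and the enumeration of entries matter; the cost is not that of a linear search.\<close>

datatype 'a timed = Timed (result: 'a) (ticks: nat)

definition return :: "'a \<Rightarrow> 'a timed" where
  "return x = Timed x 0"

definition bind_timed :: "'a timed \<Rightarrow> ('a \<Rightarrow> 'b timed) \<Rightarrow> 'b timed" where
  "bind_timed m f = Timed (result (f (result m))) (ticks m + ticks (f (result m)))"

adhoc_overloading Monad_Syntax.bind \<rightleftharpoons> bind_timed

definition tick :: "unit timed" where
  "tick = Timed () 1"

definition project_t :: "'v set \<Rightarrow> ('v, 'd) tuple \<Rightarrow> ('v, 'd) tuple timed" where
  "project_t X x = Timed (restrict x X) (1 + card X)"

text \<open>Absent tuples have annotation \<open>\<zero>\<close>.\<close>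

definition annotation :: "('k, 'm) ring_scheme \<Rightarrow> ('a \<times> 'k) list \<Rightarrow> 'a \<Rightarrow> 'k" where
  "annotation K T x = (case map_of T x of None \<Rightarrow> \<zero>\<^bsub>K\<^esub> | Some a \<Rightarrow> a)"

definition lookup_t ::
  "('k, 'm) ring_scheme \<Rightarrow> 'v set \<Rightarrow> (('v, 'd) tuple \<times> 'k) list \<Rightarrow> ('v, 'd) tuple \<Rightarrow> 'k timed" where
  "lookup_t K X T x = Timed (annotation K T x) (1 + card X)"

definition member_t ::
  "'v set \<Rightarrow> (('v, 'd) tuple \<times> 'k) list \<Rightarrow> ('v, 'd) tuple \<Rightarrow> bool timed" where
  "member_t X T x = Timed (map_of T x \<noteq> None) (1 + card X)"

definition update_t :: "'v set \<Rightarrow> ('v, 'd) tuple \<Rightarrow> 'k \<Rightarrow>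
    (('v, 'd) tuple \<times> 'k) list \<Rightarrow> (('v, 'd) tuple \<times> 'k) list timed" where
  "update_t X x a T = Timed (AList.update x a T) (1 + card X)"

definition add_t :: "('k, 'm) ring_scheme \<Rightarrow> 'k \<Rightarrow> 'k \<Rightarrow> 'k timed" where
  "add_t K a b = Timed (a \<oplus>\<^bsub>K\<^esub> b) 1"

definition mult_t :: "('k, 'm) ring_scheme \<Rightarrow> 'k \<Rightarrow> 'k \<Rightarrow> 'k timed" where
  "mult_t K a b = Timed (a \<otimes>\<^bsub>K\<^esub> b) 1"

definition is_zero_t :: "('k, 'm) ring_scheme \<Rightarrow> 'k \<Rightarrow> bool timed" where
  "is_zero_t K a = Timed (a = \<zero>\<^bsub>K\<^esub>) 1"

fun drop_zeros :: "('k, 'm) ring_scheme \<Rightarrow> ('a \<times> 'k) list \<Rightarrow> ('a \<times> 'k) list timed" where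
  "drop_zeros K [] = do { tick; return [] }"
| "drop_zeros K ((x, a) # L) = do {
     tick;
     z \<leftarrow> is_zero_t K a;
     M \<leftarrow> drop_zeros K L;
     return (if z then M else (x, a) # M) }"

fun aggregate :: "('k, 'm) ring_scheme \<Rightarrow> 'v set \<Rightarrow> (('v, 'd) tuple \<times> 'k) list \<Rightarrow>
    (('v, 'd) tuple \<times> 'k) list \<Rightarrow> (('v, 'd) tuple \<times> 'k) list timed" where
  "aggregate K X [] T = do { tick; return T }"
| "aggregate K X ((x, a) # L) T = do {
     tick;
     x' \<leftarrow> project_t X x;
     b \<leftarrow> lookup_t K X T x';
     c \<leftarrow> add_t K b a;
     T' \<leftarrow> update_t X x' c T;
     aggregate K X L T' }"

text \<open>In \<open>rule1_prog\<close>, \<open>X\<close> is the variable set of the new atom and \<open>L\<close> lists the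
  stored facts of the old one.\<close>

definition rule1_prog :: "('k, 'm) ring_scheme \<Rightarrow> 'v set \<Rightarrow> (('v, 'd) tuple \<times> 'k) list \<Rightarrow>
    (('v, 'd) tuple \<times> 'k) list timed" where
  "rule1_prog K X L = do { T \<leftarrow> aggregate K X L []; drop_zeros K T }"

fun build_table :: "'v set \<Rightarrow> (('v, 'd) tuple \<times> 'k) list \<Rightarrow>
    (('v, 'd) tuple \<times> 'k) list \<Rightarrow> (('v, 'd) tuple \<times> 'k) list timed" where
  "build_table X [] T = do { tick; return T }"
| "build_table X ((x, a) # L) T = do {
     tick;
     T' \<leftarrow> update_t X x a T;
     build_table X L T' }"

fun mult_all :: "('k, 'm) ring_scheme \<Rightarrow> 'v set \<Rightarrow> (('v, 'd) tuple \<times> 'k) list \<Rightarrow>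
    (('v, 'd) tuple \<times> 'k) list \<Rightarrow> (('v, 'd) tuple \<times> 'k) list \<Rightarrow>
    (('v, 'd) tuple \<times> 'k) list timed" where
  "mult_all K X T2 [] M = do { tick; return M }"
| "mult_all K X T2 ((x, a) # L1) M = do {
     tick;
     b \<leftarrow> lookup_t K X T2 x;
     c \<leftarrow> mult_t K a b;
     mult_all K X T2 L1 ((x, c) # M) }"

text \<open>Since \<open>\<zero>\<close> need not annihilate, tuples that occur in the second relation only
  have to be processed as well.\<close>

fun mult_unmatched :: "('k, 'm) ring_scheme \<Rightarrow> 'v set \<Rightarrow> (('v, 'd) tuple \<times> 'k) list \<Rightarrow>
    (('v, 'd) tuple \<times> 'k) list \<Rightarrow> (('v, 'd) tuple \<times> 'k) list \<Rightarrow>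
    (('v, 'd) tuple \<times> 'k) list timed" where
  "mult_unmatched K X T1 [] M = do { tick; return M }"
| "mult_unmatched K X T1 ((x, b) # L2) M = do {
     tick;
     m \<leftarrow> member_t X T1 x;
     if m then mult_unmatched K X T1 L2 M
     else do {
       c \<leftarrow> mult_t K \<zero>\<^bsub>K\<^esub> b;
       mult_unmatched K X T1 L2 ((x, c) # M) } }"

definition rule2_prog :: "('k, 'm) ring_scheme \<Rightarrow> 'v set \<Rightarrow> (('v, 'd) tuple \<times> 'k) list \<Rightarrow>
    (('v, 'd) tuple \<times> 'k) list \<Rightarrow> (('v, 'd) tuple \<times> 'k) list timed" where
  "rule2_prog K X L1 L2 = do {
     T1 \<leftarrow> build_table X L1 [];
     T2 \<leftarrow> build_table X L2 [];
     M \<leftarrow> mult_all K X T2 L1 [];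
     M' \<leftarrow> mult_unmatched K X T1 L2 M;
     drop_zeros K M' }"

text \<open>The relations produced by the two rules. The sum over the whole domain in Rule 1 is the
  finite sum over the nonzero summands.\<close>

definition rule1_rel ::
  "('k, 'm) ring_scheme \<Rightarrow> 'v \<Rightarrow> ('v, 'd, 'k) rel \<Rightarrow> ('v, 'd, 'k) rel" where
  "rule1_rel K Y r = (\<lambda>x'. \<Oplus>\<^bsub>K\<^esub>y\<in>{y. r (x'(Y := y)) \<noteq> \<zero>\<^bsub>K\<^esub>}. r (x'(Y := y)))"

definition rule2_rel ::
  "('k, 'm) ring_scheme \<Rightarrow> ('v, 'd, 'k) rel \<Rightarrow> ('v, 'd, 'k) rel \<Rightarrow> ('v, 'd, 'k) rel" where
  "rule2_rel K r1 r2 = (\<lambda>x. r1 x \<otimes>\<^bsub>K\<^esub> r2 x)"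

lemma bind_timed_simps [simp]:
  "result (bind_timed m f) = result (f (result m))"
  "ticks (bind_timed m f) = ticks m + ticks (f (result m))"
  "result (return x) = x" "ticks (return x) = 0" "ticks tick = 1"
  by (auto simp: bind_timed_def return_def tick_def)

lemmas timed_ops_def = project_t_def lookup_t_def member_t_def update_t_def add_t_def mult_t_def
  is_zero_t_def

lemma annotation_update:
  "annotation K (AList.update x a T) z = (if z = x then a else annotation K T z)"
  by (auto simp: annotation_def update_conv')

lemma annotation_eqI:
  "\<lbrakk>distinct (map fst T); (x, a) \<in> set T\<rbrakk> \<Longrightarrow> annotation K T x = a"
  by (simp add: annotation_def)

lemma annotation_absent:
  "x \<notin> fst ` set T \<Longrightarrow> annotation K T x = \<zero>\<^bsub>K\<^esub>"
  by (simp add: annotation_def map_of_eq_None_iff[THEN iffD2])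

lemma result_drop_zeros:
  "result (drop_zeros K L) = filter (\<lambda>e. snd e \<noteq> \<zero>\<^bsub>K\<^esub>) L"
  by (induction L) (auto simp: is_zero_t_def)

lemma distinct_map_fst_filter:
  "distinct (map fst L) \<Longrightarrow> distinct (map fst (filter P L))"
  by (induction L) auto

lemma storesI:
  assumes "distinct (map fst T)" "fst ` set T \<subseteq> tuples X"
    and "\<And>x. x \<in> tuples X \<Longrightarrow> annotation K T x = r x"
  shows "stores K X r (filter (\<lambda>e. snd e \<noteq> \<zero>\<^bsub>K\<^esub>) T)"
proof -
  have "(x, a) \<in> set T \<and> a \<noteq> \<zero>\<^bsub>K\<^esub> \<longleftrightarrow> x \<in> tuples X \<and> a = r x \<and> r x \<noteq> \<zero>\<^bsub>K\<^esub>" for x a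
  proof
    assume "(x, a) \<in> set T \<and> a \<noteq> \<zero>\<^bsub>K\<^esub>"
    then show "x \<in> tuples X \<and> a = r x \<and> r x \<noteq> \<zero>\<^bsub>K\<^esub>"
      using assms annotation_eqI[of T x a K] by force
  next
    assume *: "x \<in> tuples X \<and> a = r x \<and> r x \<noteq> \<zero>\<^bsub>K\<^esub>"
    then have "annotation K T x = a" "a \<noteq> \<zero>\<^bsub>K\<^esub>" using assms(3) by auto
    then show "(x, a) \<in> set T \<and> a \<noteq> \<zero>\<^bsub>K\<^esub>"
      by (auto simp: annotation_def dest: map_of_SomeD split: option.splits)
  qed
  then have "e \<in> set (filter (\<lambda>e. snd e \<noteq> \<zero>\<^bsub>K\<^esub>) T) \<longleftrightarrow>
      e \<in> {(x, r x) | x. x \<in> tuples X \<and> r x \<noteq> \<zero>\<^bsub>K\<^esub>}" for e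
    by (cases e) auto
  then show ?thesis
    unfolding stores_def using distinct_map_fst_filter[OF assms(1)] by blast
qed

lemma stores_annotation:
  assumes "stores K X r L" "x \<in> tuples X"
  shows "annotation K L x = r x"
proof (cases "r x = \<zero>\<^bsub>K\<^esub>")
  case True
  then show ?thesis using assms by (subst annotation_absent) (auto simp: stores_def)
next
  case False
  then show ?thesis using assms by (intro annotation_eqI) (auto simp: stores_def)
qed

context two_monoid
begin

lemma aggregate_correct:
  fixes Z :: "'v set" and L T :: "(('v, 'd) tuple \<times> 'a) list"
  assumes "distinct L" "distinct (map fst T)"
    and "snd ` set L \<subseteq> carrier K" "\<And>z. annotation K T z \<in> carrier K"
  defines "T' \<equiv> result (aggregate K Z L T)"
  shows "distinct (map fst T') \<and>
    fst ` set T' = fst ` set T \<union> (\<lambda>e. restrict (fst e) Z) ` set L \<and>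
    (\<forall>z. annotation K T' z = annotation K T z \<oplus>
       (\<Oplus>e\<in>{e \<in> set L. restrict (fst e) Z = z}. snd e))"
  using assms(1-4) unfolding T'_def
proof (induction L arbitrary: T)
  case Nil
  then show ?case by simp
next
  case (Cons e L)
  obtain x a where e: "e = (x, a)" by (cases e)
  define x' where "x' = restrict x Z"
  define U where "U = AList.update x' (annotation K T x' \<oplus> a) T"
  have a: "a \<in> carrier K" using Cons.prems e by auto
  have ann: "annotation K U z = (if z = x' then annotation K T x' \<oplus> a else annotation K T z)" for z
    by (simp add: U_def annotation_update)
  have *: "result (aggregate K Z (e # L) T) = result (aggregate K Z L U)"
    by (simp add: e timed_ops_def U_def x'_def)
  have IH: "distinct (map fst (result (aggregate K Z L U))) \<and>
    fst ` set (result (aggregate K Z L U)) = fst ` set U \<union> (\<lambda>e. restrict (fst e) Z) ` set L \<and>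
    (\<forall>z. annotation K (result (aggregate K Z L U)) z = annotation K U z \<oplus>
       (\<Oplus>e\<in>{e \<in> set L. restrict (fst e) Z = z}. snd e))"
    using Cons.prems a by (intro Cons.IH) (auto simp: ann, simp add: U_def distinct_update)
  have sum: "annotation K U z \<oplus> (\<Oplus>e\<in>{e \<in> set L. restrict (fst e) Z = z}. snd e) =
      annotation K T z \<oplus> (\<Oplus>e\<in>{f \<in> set (e # L). restrict (fst f) Z = z}. snd e)" for z
  proof (cases "z = x'")
    case True
    have "{f \<in> set (e # L). restrict (fst f) Z = z} =
        insert e {e \<in> set L. restrict (fst e) Z = z}"
      using True by (auto simp: x'_def e)
    moreover have "(\<Oplus>e\<in>insert e {e \<in> set L. restrict (fst e) Z = z}. snd e) =
        a \<oplus> (\<Oplus>e\<in>{e \<in> set L. restrict (fst e) Z = z}. snd e)"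
      using Cons.prems a by (subst finsum_insert) (auto simp: e)
    moreover have "(\<Oplus>e\<in>{e \<in> set L. restrict (fst e) Z = z}. snd e) \<in> carrier K"
      using Cons.prems by (intro finsum_closed) auto
    ultimately show ?thesis using True Cons.prems a by (simp add: ann a_assoc)
  next
    case False
    then have "{f \<in> set (e # L). restrict (fst f) Z = z} = {e \<in> set L. restrict (fst e) Z = z}"
      by (auto simp: x'_def e)
    then show ?thesis using False by (simp add: ann)
  qed
  have keys: "fst ` set U = insert x' (fst ` set T)" by (simp add: U_def dom_update)
  show ?case using IH unfolding * sum keys
    by (simp add: x'_def e del: restrict_apply restrict_apply')
qed

lemma restrict_eq_fun_upd:
  assumes "x \<in> tuples X" "Y \<in> X" "z \<in> tuples (X - {Y})"
  shows "restrict x (X - {Y}) = z \<longleftrightarrow> (\<exists>y. x = z(Y := y))"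
  using assms
  by (fastforce simp: tuples_def restrict_def fun_eq_iff PiE_iff extensional_def split: if_splits
      intro!: exI[of _ "x Y"])

lemma rule1_prog_correct:
  assumes r: "annotated_relation K X r" "stores K X r L" and Y: "Y \<in> X"
  shows "stores K (X - {Y}) (rule1_rel K Y r) (result (rule1_prog K (X - {Y}) L))"
proof -
  define Z where "Z = X - {Y}"
  define T where "T = result (aggregate K Z L [])"
  have L: "distinct L" "snd ` set L \<subseteq> carrier K" "fst ` set L \<subseteq> tuples X"
    using r by (auto simp: stores_def annotated_relation_def distinct_map)
  have T: "distinct (map fst T)" "fst ` set T = (\<lambda>e. restrict (fst e) Z) ` set L"
    "\<And>z. annotation K T z = (\<Oplus>e\<in>{e \<in> set L. restrict (fst e) Z = z}. snd e)"
    using aggregate_correct[OF L(1) _ L(2), of "[]" Z] L(2)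
    by (auto simp: T_def annotation_def intro!: l_zero finsum_closed)
  have "annotation K T z = rule1_rel K Y r z" if z: "z \<in> tuples Z" for z
  proof -
    have upd: "z(Y := y) \<in> tuples X" for y
      using z Y by (auto simp: Z_def tuples_def PiE_iff extensional_def)
    have inj: "inj_on (\<lambda>y. (z(Y := y), r (z(Y := y)))) S" for S
      by (auto simp: inj_on_def dest: fun_upd_eqD)
    have "{e \<in> set L. restrict (fst e) Z = z} =
        (\<lambda>y. (z(Y := y), r (z(Y := y)))) ` {y. r (z(Y := y)) \<noteq> \<zero>}"
      (is "?A = ?B")
    proof (rule Set.set_eqI)
      fix e
      have "e \<in> ?A \<longleftrightarrow> (\<exists>x. e = (x, r x) \<and> x \<in> tuples X \<and> r x \<noteq> \<zero> \<and> restrict x Z = z)"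
        using r(2) by (auto simp: stores_def)
      also have "\<dots> \<longleftrightarrow> (\<exists>x. e = (x, r x) \<and> x \<in> tuples X \<and> r x \<noteq> \<zero> \<and> (\<exists>y. x = z(Y := y)))"
        using restrict_eq_fun_upd[OF _ Y z[unfolded Z_def]] unfolding Z_def by metis
      also have "\<dots> \<longleftrightarrow> e \<in> ?B"
        using upd by blast
      finally show "e \<in> ?A \<longleftrightarrow> e \<in> ?B" .
    qed
    then show ?thesis
      using r(1) upd unfolding T(3) rule1_rel_def
      by (simp only:) (subst finsum_reindex[OF _ inj], auto simp: annotated_relation_def)
  qed
  moreover have "fst ` set T \<subseteq> tuples Z"
    using T(2) by (auto simp: tuples_def)
  moreover have "result (rule1_prog K Z L) = filter (\<lambda>e. snd e \<noteq> \<zero>) T"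
    by (simp add: rule1_prog_def T_def result_drop_zeros)
  ultimately show ?thesis
    using storesI[OF T(1), of Z K "rule1_rel K Y r"] by (simp add: Z_def)
qed

lemma build_table_correct:
  "distinct (map fst T) \<Longrightarrow> distinct (map fst L) \<Longrightarrow>
   map_of (result (build_table X L T)) = map_of T ++ map_of L"
proof (induction L arbitrary: T)
  case (Cons e L)
  obtain x a where e: "e = (x, a)" by (cases e)
  have "(map_of T)(x \<mapsto> a) ++ map_of L = map_of T ++ map_of (e # L)"
    using Cons.prems by (simp add: e map_add_upd_left dom_map_of_conv_image_fst)
  moreover have "map_of (result (build_table X L (AList.update x a T))) =
      map_of (AList.update x a T) ++ map_of L"
    using Cons by (simp add: distinct_update)
  ultimately show ?case
    by (simp only: e build_table.simps bind_timed_simps update_t_def timed.sel update_conv')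
qed auto

lemma mult_all_correct:
  "result (mult_all K X T L M) = rev (map (\<lambda>(x, a). (x, a \<otimes> annotation K T x)) L) @ M"
  by (induction L arbitrary: M) (auto simp: timed_ops_def)

lemma mult_unmatched_correct:
  "result (mult_unmatched K X T L M) =
   rev (map (\<lambda>(x, b). (x, \<zero> \<otimes> b)) (filter (\<lambda>e. map_of T (fst e) = None) L)) @ M"
  by (induction L arbitrary: M) (auto simp: timed_ops_def)

lemma rule2_prog_correct:
  assumes r1: "annotated_relation K X r1" "stores K X r1 L1"
    and r2: "annotated_relation K X r2" "stores K X r2 L2"
  shows "stores K X (rule2_rel K r1 r2) (result (rule2_prog K X L1 L2))"
proof -
  define T1 where "T1 = result (build_table X L1 [])"
  define T2 where "T2 = result (build_table X L2 [])"
  define U where "U = filter (\<lambda>e. map_of T1 (fst e) = None) L2"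
  define M where "M = rev (map (\<lambda>(x, b). (x, \<zero> \<otimes> b)) U) @
    rev (map (\<lambda>(x, a). (x, a \<otimes> annotation K T2 x)) L1)"
  have d: "distinct (map fst L1)" "distinct (map fst L2)"
    using r1 r2 by (auto simp: stores_def)
  have m: "map_of T1 = map_of L1" "map_of T2 = map_of L2"
    using build_table_correct[of "[]"] d by (auto simp: T1_def T2_def)
  have ann: "annotation K T2 = annotation K L2" by (auto simp: annotation_def m)
  have keys: "map fst M = rev (map fst U) @ rev (map fst L1)"
    by (simp add: M_def rev_map comp_def case_prod_beta)
  have U: "set U = {e \<in> set L2. fst e \<notin> fst ` set L1}"
    by (auto simp: U_def m map_of_eq_None_iff)
  have dist: "distinct (map fst M)"
    unfolding keys using d distinct_map_fst_filter[OF d(2)] U by (auto simp: U_def)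
  have sub: "fst ` set M \<subseteq> tuples X"
    using r1(2) r2(2) by (force simp: M_def U stores_def)
  have "annotation K M x = rule2_rel K r1 r2 x" if x: "x \<in> tuples X" for x
  proof (cases "r1 x = \<zero>")
    case r1x: False
    then have "(x, r1 x) \<in> set L1" using x r1(2) by (auto simp: stores_def)
    then have "(x, r1 x \<otimes> annotation K T2 x) \<in> set M" by (force simp: M_def)
    then show ?thesis
      using annotation_eqI[OF dist] stores_annotation[OF r2(2) x] by (simp add: ann rule2_rel_def)
  next
    case r1x: True
    then have x1: "x \<notin> fst ` set L1" using r1(2) by (auto simp: stores_def)
    show ?thesis
    proof (cases "r2 x = \<zero>")
      case True
      then have "x \<notin> fst ` set L2" using r2(2) by (auto simp: stores_def)
      then have "x \<notin> fst ` set M" using x1 by (force simp: M_def U)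
      then show ?thesis
        using r1x True zero_mult_zero by (simp add: annotation_absent rule2_rel_def)
    next
      case False
      then have "(x, r2 x) \<in> set U" using x r2(2) x1 by (auto simp: stores_def U)
      then have "(x, \<zero> \<otimes> r2 x) \<in> set M" by (force simp: M_def)
      then show ?thesis using annotation_eqI[OF dist] r1x by (simp add: rule2_rel_def)
    qed
  qed
  moreover have "result (rule2_prog K X L1 L2) = filter (\<lambda>e. snd e \<noteq> \<zero>) M"
    by (simp add: rule2_prog_def result_drop_zeros mult_all_correct mult_unmatched_correct
        T1_def T2_def U_def M_def)
  ultimately show ?thesis using storesI[OF dist sub, of K "rule2_rel K r1 r2"] by simp
qed

end

text \<open>\<open>Running q A\<close> is a state at the head of the while loop.\<close>

datatype ('r, 'v, 'd, 'k) config =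
  Running "('r, 'v) query" "('r, 'v, 'd, 'k) adb" | Output 'k | Not_Hierarchical

definition eliminable :: "('r, 'v) query \<Rightarrow> 'v \<Rightarrow> ('r, 'v) atom \<Rightarrow> bool" where
  "eliminable q Y \<alpha> \<longleftrightarrow> atoms_with q Y = {\<alpha>}"

definition mergeable :: "('r, 'v) query \<Rightarrow> 'r \<Rightarrow> 'r \<Rightarrow> 'v set \<Rightarrow> bool" where
  "mergeable q R1 R2 X \<longleftrightarrow> R1 \<noteq> R2 \<and> (R1, X) \<in> q \<and> (R2, X) \<in> q"

text \<open>Selecting the rule to apply only needs the query. The square of its size accounts for the
  naive search that compares any two occurrences of symbols.\<close>

definition selection_cost :: "('r, 'v) query \<Rightarrow> nat" where
  "selection_cost q = (\<Sum>(R, X)\<in>q. 1 + card X)\<^sup>2"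

text \<open>One iteration, together with its running time. The choice of the variable, of the atoms and
  of the name of the new atom is arbitrary (the name of a removed atom may be used again), and so
  is the order in which stored facts are listed. The time is that of the programs above, whose
  results are the new relations by \<open>rule1_prog_correct\<close> and \<open>rule2_prog_correct\<close>.\<close>

inductive hea_step :: "('k, 'm) ring_scheme \<Rightarrow>
    ('r, 'v, 'd, 'k) config \<Rightarrow> nat \<Rightarrow> ('r, 'v, 'd, 'k) config \<Rightarrow> bool" for K where
  halt: "q = {(R, {})} \<Longrightarrow> hea_step K (Running q A) (selection_cost q + 1)
      (Output (A R (\<lambda>_. undefined)))"
| rule1: "\<lbrakk>\<nexists>R0. q = {(R0, {})};
     eliminable q Y (R, X);
     q' = q - {(R, X)}; R' \<notin> fst ` q';
     stores K X (A R) L\<rbrakk>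
   \<Longrightarrow> hea_step K (Running q A)
      (selection_cost q + ticks (rule1_prog K (X - {Y}) L))
      (Running (insert (R', X - {Y}) q') (A(R' := rule1_rel K Y (A R))))"
| rule2: "\<lbrakk>\<nexists>R0. q = {(R0, {})};
     \<nexists>Y \<alpha>. eliminable q Y \<alpha>;
     mergeable q R1 R2 X;
     q' = q - {(R1, X), (R2, X)}; R' \<notin> fst ` q';
     stores K X (A R1) L1; stores K X (A R2) L2\<rbrakk>
   \<Longrightarrow> hea_step K (Running q A)
      (selection_cost q + ticks (rule2_prog K X L1 L2))
      (Running (insert (R', X) q') (A(R' := rule2_rel K (A R1) (A R2))))"
| not_hierarchical: "\<lbrakk>\<nexists>R0. q = {(R0, {})};
     \<nexists>Y \<alpha>. eliminable q Y \<alpha>;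
     \<nexists>R1 R2 X. mergeable q R1 R2 X\<rbrakk>
   \<Longrightarrow> hea_step K (Running q A) (selection_cost q) Not_Hierarchical"

inductive hea_exec :: "('k, 'm) ring_scheme \<Rightarrow>
    ('r, 'v, 'd, 'k) config \<Rightarrow> nat \<Rightarrow> ('r, 'v, 'd, 'k) config \<Rightarrow> bool" for K where
  refl: "hea_exec K c 0 c"
| step: "\<lbrakk>hea_step K c t c'; hea_exec K c' u c''\<rbrakk> \<Longrightarrow> hea_exec K c (t + u) c''"

text \<open>Whatever choices are made, the execution from \<open>c\<close> terminates, takes time at most
  \<open>B\<close> and can stop only with output \<open>k\<close>.\<close>

definition hea_outputs_within ::
  "('k, 'm) ring_scheme \<Rightarrow> ('r, 'v, 'd, 'k) config \<Rightarrow> 'k \<Rightarrow> nat \<Rightarrow> bool" where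
  "hea_outputs_within K c k B \<longleftrightarrow>
     (\<nexists>s. s 0 = c \<and> (\<forall>i. \<exists>t. hea_step K (s i) t (s (Suc i)))) \<and>
     (\<forall>t c'. hea_exec K c t c' \<longrightarrow>
        t \<le> B \<and> ((\<nexists>u c''. hea_step K c' u c'') \<longrightarrow> c' = Output k))"

end

theory Submission
  imports Defs
begin

text \<open>Correctness: every fact \<open>f\<close> of an intermediate query is interpreted as an event over the
  possible worlds of the input \<open>D\<close>, such that the events of distinct facts depend on disjoint sets of
  input facts and the annotation of \<open>f\<close> is the probability of its event. Rule 1 replaces events by
  unions and Rule 2 by intersections over disjoint groups of facts; as the members of a group are
  independent, \<open>\<oplus>\<close> and \<open>\<otimes>\<close> compute the new probabilities, and in every
  world the truth value of the query is unchanged. Since each new fact with nonzero annotation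
  consumes at least one old one, there are never more than \<open>card D\<close> stored facts. An iteration
  is therefore linear in \<open>card D\<close>, and the number of iterations is bounded by the size of
  \<open>Q\<close>, which each rule decreases.\<close>

subsection \<open>Independence in possible worlds\<close>

text \<open>Measurability with respect to the coordinates in \<open>S\<close>:
  \<open>W \<inter> S\<close> represents all worlds that agree with \<open>W\<close> on
  \<open>S\<close>.\<close>

definition determined_by :: "'f set \<Rightarrow> 'f set set \<Rightarrow> bool" where
  "determined_by S E \<longleftrightarrow> (\<forall>W. W \<in> E \<longleftrightarrow> W \<inter> S \<in> E)"

abbreviation world_prob :: "'f set \<Rightarrow> ('f \<Rightarrow> real) \<Rightarrow> 'f set set \<Rightarrow> real" where
  "world_prob D p E \<equiv> measure_pmf.prob (possible_world D p) E"

lemma determined_by_mono: "determined_by S E \<Longrightarrow> S \<subseteq> T \<Longrightarrow> determined_by T E"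
  unfolding determined_by_def by (metis inf.absorb_iff2 inf_assoc)

lemma determined_by_Compl: "determined_by S E \<Longrightarrow> determined_by S (- E)"
  by (simp add: determined_by_def)

lemma determined_by_INT:
  assumes "\<And>i. i \<in> I \<Longrightarrow> determined_by (S i) (E i)"
  shows "determined_by (\<Union>i\<in>I. S i) (\<Inter>i\<in>I. E i)"
proof -
  have "determined_by (\<Union>i\<in>I. S i) (E i)" if "i \<in> I" for i
    using assms[OF that] by (rule determined_by_mono) (use that in blast)
  then show ?thesis unfolding determined_by_def INT_iff by blast
qed

lemma determined_by_UN:
  assumes "\<And>i. i \<in> I \<Longrightarrow> determined_by (S i) (E i)"
  shows "determined_by (\<Union>i\<in>I. S i) (\<Union>i\<in>I. E i)"
  using determined_by_Compl[OF determined_by_INT[OF determined_by_Compl[OF assms]]] by simp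

lemma measure_pmf_Compl: "measure_pmf.prob M (- A) = 1 - measure_pmf.prob M A"
  using measure_pmf.prob_compl[of A M] by (simp add: Compl_eq_Diff_UNIV)

lemma measure_pair_pmf_Times:
  "measure_pmf.prob (pair_pmf M N) (A \<times> B) = measure_pmf.prob M A * measure_pmf.prob N B"
proof -
  \<comment> \<open>Cutting the factors down to the supports makes them countable, as
    \<open>measure_pmf_prob_product\<close> requires.\<close>
  have "measure_pmf.prob (pair_pmf M N) (A \<times> B) =
      measure_pmf.prob (pair_pmf M N) (A \<times> B \<inter> set_pmf (pair_pmf M N))"
    by (rule measure_Int_set_pmf[symmetric])
  also have "A \<times> B \<inter> set_pmf (pair_pmf M N) = (A \<inter> set_pmf M) \<times> (B \<inter> set_pmf N)" by auto
  also have "measure_pmf.prob (pair_pmf M N) \<dots> =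
      measure_pmf.prob M (A \<inter> set_pmf M) * measure_pmf.prob N (B \<inter> set_pmf N)"
    by (intro measure_pmf_prob_product) auto
  finally show ?thesis by (simp add: measure_Int_set_pmf)
qed

text \<open>Independence of the coordinates: the product measure over \<open>D\<close> factors into
  those over \<open>D \<inter> S\<close> and \<open>D - S\<close>.\<close>

lemma possible_world_split:
  assumes "finite D"
  shows "map_pmf (\<lambda>W. (W \<inter> S, W - S)) (possible_world D p) =
    pair_pmf (possible_world (D \<inter> S) p) (possible_world (D - S) p)"
proof -
  have "Pi_pmf D False (\<lambda>f. bernoulli_pmf (p f)) =
      map_pmf (\<lambda>(f, g) x. if x \<in> D \<inter> S then f x else g x)
       (pair_pmf (Pi_pmf (D \<inter> S) False (\<lambda>f. bernoulli_pmf (p f)))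
         (Pi_pmf (D - S) False (\<lambda>f. bernoulli_pmf (p f))))"
    using Pi_pmf_union[of "D \<inter> S" "D - S" False "\<lambda>f. bernoulli_pmf (p f)"] assms
    by (simp add: Int_Diff_Un Int_Diff_disjoint)
  then show ?thesis
    unfolding possible_world_def map_pair[symmetric]
    by (auto simp: pmf.map_comp intro!: pmf.map_cong0)
qed

text \<open>\<open>E\<close> sees only the first component of the split and, as \<open>T\<close>
  avoids \<open>S\<close>, \<open>F\<close> only the second.\<close>

lemma world_prob_Int:
  assumes "finite D" "determined_by S E" "determined_by T F" "S \<inter> T = {}"
  shows "world_prob D p (E \<inter> F) = world_prob D p E * world_prob D p F"
proof -
  have E: "W \<inter> S \<in> E \<longleftrightarrow> W \<in> E" for W
    using assms(2) by (auto simp: determined_by_def)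
  have "(W - S) \<inter> T = W \<inter> T" for W using assms(4) by auto
  then have F: "W - S \<in> F \<longleftrightarrow> W \<in> F" for W
    using assms(3) unfolding determined_by_def by metis
  have *: "measure_pmf.prob (pair_pmf (possible_world (D \<inter> S) p) (possible_world (D - S) p)) X =
      world_prob D p {W. (W \<inter> S, W - S) \<in> X}" for X
    by (simp add: possible_world_split[OF assms(1), symmetric] vimage_def)
  \<comment> \<open>With \<open>UNIV\<close> as the other factor, probabilities over the two parts
    become probabilities over \<open>D\<close>.\<close>
  have "world_prob (D \<inter> S) p E = world_prob D p E" "world_prob (D - S) p F = world_prob D p F"
    using *[of "E \<times> UNIV"] *[of "UNIV \<times> F"] by (simp_all add: measure_pair_pmf_Times E F)
  moreover have "{W. (W \<inter> S, W - S) \<in> E \<times> F} = E \<inter> F" by (auto simp: E F)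
  then have "world_prob D p (E \<inter> F) = world_prob (D \<inter> S) p E * world_prob (D - S) p F"
    using *[of "E \<times> F"] by (simp add: measure_pair_pmf_Times)
  ultimately show ?thesis by simp
qed

lemma world_prob_INT:
  assumes "finite D" "finite I" "disjoint_family_on S I"
    and "\<And>i. i \<in> I \<Longrightarrow> determined_by (S i) (E i)"
  shows "world_prob D p (\<Inter>i\<in>I. E i) = (\<Prod>i\<in>I. world_prob D p (E i))"
  using assms(2-)
proof (induction I rule: finite_induct)
  case (insert i I)
  have "S i \<inter> (\<Union>i\<in>I. S i) = {}"
    using insert.prems(1) insert.hyps(2) by (fastforce simp: disjoint_family_on_def)
  then have "world_prob D p (E i \<inter> (\<Inter>i\<in>I. E i)) =
      world_prob D p (E i) * world_prob D p (\<Inter>i\<in>I. E i)"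
    using insert.prems(2) by (intro world_prob_Int[OF assms(1)]) (auto intro: determined_by_INT)
  then show ?case
    using insert by (auto simp: disjoint_family_on_def)
qed simp

text \<open>The index set may be infinite, as Rule 1 ranges over the whole domain. Events of
  probability 0 miss the support of the pmf, so even infinitely many of them do not affect the
  union; the finite rest is handled by complements.\<close>

lemma world_prob_UN:
  assumes "finite D" "disjoint_family_on S I" "finite {i \<in> I. world_prob D p (E i) \<noteq> 0}"
    and det: "\<And>i. i \<in> I \<Longrightarrow> determined_by (S i) (E i)"
  shows "world_prob D p (\<Union>i\<in>I. E i) =
    1 - (\<Prod>i\<in>{i \<in> I. world_prob D p (E i) \<noteq> 0}. 1 - world_prob D p (E i))"
proof -
  define J where "J = {i \<in> I. world_prob D p (E i) \<noteq> 0}"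
  have "E i \<inter> set_pmf (possible_world D p) = {}" if "i \<in> I - J" for i
    using that by (auto simp: J_def measure_pmf_zero_iff)
  then have "(\<Union>i\<in>I. E i) \<inter> set_pmf (possible_world D p) =
      (\<Union>i\<in>J. E i) \<inter> set_pmf (possible_world D p)"
    by (auto simp: J_def)
  then have "world_prob D p (\<Union>i\<in>I. E i) = world_prob D p (\<Union>i\<in>J. E i)"
    by (metis measure_Int_set_pmf)
  also have "\<dots> = world_prob D p (- (\<Inter>i\<in>J. - E i))" by simp
  also have "\<dots> = 1 - world_prob D p (\<Inter>i\<in>J. - E i)"
    by (rule measure_pmf_Compl)
  also have "world_prob D p (\<Inter>i\<in>J. - E i) = (\<Prod>i\<in>J. world_prob D p (- E i))"
    using assms(2,3) det
    by (intro world_prob_INT[OF assms(1), where S = S])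
      (auto simp: J_def disjoint_family_on_def intro: determined_by_Compl)
  also have "\<dots> = (\<Prod>i\<in>J. 1 - world_prob D p (E i))"
    by (simp add: measure_pmf_Compl)
  finally show ?thesis by (simp add: J_def)
qed

lemma world_prob_member:
  assumes "finite D" "f \<in> D \<Longrightarrow> 0 \<le> p f \<and> p f \<le> 1"
  shows "world_prob D p {W. f \<in> W} = (if f \<in> D then p f else 0)"
proof -
  \<comment> \<open>The event reads only coordinate \<open>f\<close>, whose marginal is Bernoulli if
    \<open>f \<in> D\<close>; otherwise the added conjunct makes it empty.\<close>
  have "world_prob D p {W. f \<in> W} =
      measure_pmf.prob (map_pmf (\<lambda>b. b f) (Pi_pmf D False (\<lambda>f. bernoulli_pmf (p f))))
        {b. b \<and> f \<in> D}"
    by (simp add: possible_world_def vimage_def conj_commute)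
  moreover have true: "{b. b} = {True}" by auto
  ultimately show ?thesis
    using assms by (auto simp: Pi_pmf_component true measure_pmf_single)
qed

section \<open>Sums in the 2-monoid of probabilities\<close>

interpretation prob_monoid: two_monoid prob_monoid
  by (rule two_monoid_prob_monoid)

text \<open>Passing to complements turns \<open>\<oplus>\<close> into multiplication.\<close>

lemma finsum_prob_monoid:
  assumes "finite I" "\<And>i. i \<in> I \<Longrightarrow> 0 \<le> f i \<and> f i \<le> 1"
  shows "(\<Oplus>\<^bsub>prob_monoid\<^esub>i\<in>I. f i) = 1 - (\<Prod>i\<in>I. 1 - f i)"
  using assms
proof (induction I rule: finite_induct)
  case empty
  have "\<zero>\<^bsub>prob_monoid\<^esub> = 0" by (simp add: prob_monoid_def)
  then show ?case by simp
next
  case (insert i I)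
  have "(\<Oplus>\<^bsub>prob_monoid\<^esub>j\<in>insert i I. f j) = f i \<oplus>\<^bsub>prob_monoid\<^esub> (\<Oplus>\<^bsub>prob_monoid\<^esub>j\<in>I. f j)"
    using insert by (intro prob_monoid.finsum_insert) (auto simp: prob_monoid_def)
  also have "\<dots> = f i \<oplus>\<^bsub>prob_monoid\<^esub> (1 - (\<Prod>i\<in>I. 1 - f i))"
    using insert by simp
  finally show ?case using insert by (simp add: prob_monoid_def)
qed


lemma zero_prob_monoid [simp]: "\<zero>\<^bsub>prob_monoid\<^esub> = 0"
  by (simp add: prob_monoid_def)

subsection \<open>Queries under the two rules\<close>

text \<open>Only the restrictions of \<open>w\<close> to atoms matter, so \<open>w\<close> may be
  any function and can be updated freely.\<close>

lemma query_true_iff: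
  "query_true Q W \<longleftrightarrow> (\<exists>w. \<forall>(R, X)\<in>Q. (R, restrict w X) \<in> W)"
proof
  assume "\<exists>w. \<forall>(R, X)\<in>Q. (R, restrict w X) \<in> W"
  then obtain w where w: "\<And>R X. (R, X) \<in> Q \<Longrightarrow> (R, restrict w X) \<in> W" by blast
  have "restrict (restrict w (vars Q)) X = restrict w X" if "(R, X) \<in> Q" for R X
  proof -
    have "vars Q \<inter> X = X" using that by (auto simp: vars_def)
    then show ?thesis by (simp add: restrict_restrict)
  qed
  moreover have "restrict w (vars Q) \<in> tuples (vars Q)" by (simp add: tuples_def)
  ultimately show "query_true Q W"
    unfolding query_true_def using w by (intro bexI[of _ "restrict w (vars Q)"]) auto
qed (auto simp: query_true_def)

lemma vars_eq: "Z \<in> vars q \<longleftrightarrow> atoms_with q Z \<noteq> {}"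
  by (auto simp: vars_def atoms_with_def)

lemma eliminableD:
  assumes "eliminable q Y (R, X)"
  shows "(R, X) \<in> q" "Y \<in> X" "(P, Z) \<in> q \<Longrightarrow> Y \<in> Z \<Longrightarrow> (P, Z) = (R, X)"
  using assms by (auto simp: eliminable_def atoms_with_def)

lemma sjf_bcq_insert:
  assumes "sjf_bcq q" "q0 \<subseteq> q" "R \<notin> fst ` q0" "finite X"
  shows "sjf_bcq (insert (R, X) q0)"
  using assms finite_subset[OF assms(2)] inj_on_subset[OF _ assms(2)]
  by (auto simp: sjf_bcq_def)

text \<open>Images preserve inclusions. They preserve disjointness here because \<open>g\<close>
  identifies only atoms with equal variable sets, and such atoms lie in the same sets
  \<open>atoms_with q Z\<close>.\<close>

lemma hierarchical_image:
  assumes "hierarchical q"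
    and g: "\<And>Z. Z \<in> vars q' \<Longrightarrow> atoms_with q' Z = g ` atoms_with q Z"
    and eq: "\<And>a b. a \<in> q \<Longrightarrow> b \<in> q \<Longrightarrow> g a = g b \<Longrightarrow> a = b \<or> snd a = snd b"
  shows "hierarchical q'"
  unfolding hierarchical_def
proof (intro ballI)
  fix Z Z' assume Z: "Z \<in> vars q'" "Z' \<in> vars q'"
  then have "Z \<in> vars q" "Z' \<in> vars q" using g[OF Z(1)] g[OF Z(2)] by (auto simp: vars_eq)
  then consider "atoms_with q Z \<subseteq> atoms_with q Z'" | "atoms_with q Z' \<subseteq> atoms_with q Z"
    | "atoms_with q Z \<inter> atoms_with q Z' = {}"
    using assms(1) by (auto simp: hierarchical_def)
  then show "atoms_with q' Z \<subseteq> atoms_with q' Z' \<or> atoms_with q' Z' \<subseteq> atoms_with q' Z \<or>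
     atoms_with q' Z \<inter> atoms_with q' Z' = {}"
  proof cases
    case 3
    have False if ab: "a \<in> atoms_with q Z" "b \<in> atoms_with q Z'" "g a = g b" for a b
    proof -
      have "a = b \<or> snd a = snd b" using ab by (intro eq) (auto simp: atoms_with_def)
      then have "a \<in> atoms_with q Z'" using ab by (auto simp: atoms_with_def)
      then show False using 3 ab by auto
    qed
    then have "g ` atoms_with q Z \<inter> g ` atoms_with q Z' = {}" by blast
    then show ?thesis using Z by (simp add: g)
  qed (use Z g in auto)
qed

text \<open>\<open>Y\<close> does not survive, and freshness of \<open>R'\<close> makes the
  replacement of the atom injective.\<close>

lemma hierarchical_eliminate:
  assumes "hierarchical q" "eliminable q Y (R, X)" "R' \<notin> fst ` (q - {(R, X)})"
  shows "hierarchical (insert (R', X - {Y}) (q - {(R, X)}))" (is "hierarchical ?q")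
proof (rule hierarchical_image[OF assms(1)])
  let ?g = "\<lambda>a. if a = (R, X) then (R', X - {Y}) else a"
  note e = eliminableD[OF assms(2)]
  show "atoms_with ?q Z = ?g ` atoms_with q Z" if "Z \<in> vars ?q" for Z
  proof -
    have "Z \<noteq> Y" using that e(3) by (auto simp: vars_def)
    then show ?thesis using e(1) by (force simp: atoms_with_def)
  qed
  show "a = b \<or> snd a = snd b" if "a \<in> q" "b \<in> q" "?g a = ?g b" for a b
    using that assms(3) by (force split: if_splits)
qed

text \<open>The replacement identifies two atoms over the same variable set and, by freshness of
  \<open>R'\<close>, nothing else.\<close>

lemma hierarchical_merge:
  assumes "hierarchical q" "mergeable q R1 R2 X" "R' \<notin> fst ` (q - {(R1, X), (R2, X)})"
  shows "hierarchical (insert (R', X) (q - {(R1, X), (R2, X)}))" (is "hierarchical ?q")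
proof (rule hierarchical_image[OF assms(1)])
  let ?g = "\<lambda>a. if a \<in> {(R1, X), (R2, X)} then (R', X) else a"
  show "atoms_with ?q Z = ?g ` atoms_with q Z" for Z
    using assms(2) by (force simp: atoms_with_def mergeable_def)
  show "a = b \<or> snd a = snd b" if "a \<in> q" "b \<in> q" "?g a = ?g b" for a b
    using that assms(3) by (force split: if_splits)
qed

text \<open>\<open>Y\<close> occurs in no other atom, so its existential quantifier can be moved
  into the one atom containing it.\<close>

lemma query_true_eliminate:
  assumes "eliminable q Y (R, X)" "R' \<notin> fst ` (q - {(R, X)})"
    and R': "\<And>x. (R', x) \<in> W' \<longleftrightarrow> (\<exists>y. (R, x(Y := y)) \<in> W)"
    and P: "\<And>P x. P \<noteq> R' \<Longrightarrow> (P, x) \<in> W' \<longleftrightarrow> (P, x) \<in> W"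
  shows "query_true (insert (R', X - {Y}) (q - {(R, X)})) W' \<longleftrightarrow> query_true q W"
proof
  note e = eliminableD[OF assms(1)]
  have upd: "(restrict w (X - {Y}))(Y := y) = restrict (w(Y := y)) X" for w :: "'b \<Rightarrow> 'c" and y
    using e(2) by (auto simp: fun_eq_iff restrict_def)
  {
    assume "query_true q W"
    then obtain w where w: "\<And>P Z. (P, Z) \<in> q \<Longrightarrow> (P, restrict w Z) \<in> W"
      unfolding query_true_iff by blast
    have "(R, (restrict w (X - {Y}))(Y := w Y)) \<in> W" using w e(1) by (simp add: upd)
    then have "(R', restrict w (X - {Y})) \<in> W'" unfolding R' by blast
    moreover have "(P, restrict w Z) \<in> W'" if "(P, Z) \<in> q - {(R, X)}" for P Z
      using that assms(2) w by (subst P) force+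
    ultimately show "query_true (insert (R', X - {Y}) (q - {(R, X)})) W'"
      unfolding query_true_iff by blast
  next
    assume "query_true (insert (R', X - {Y}) (q - {(R, X)})) W'"
    then obtain w where w: "(R', restrict w (X - {Y})) \<in> W'"
      "\<And>P Z. (P, Z) \<in> q - {(R, X)} \<Longrightarrow> (P, restrict w Z) \<in> W'"
      unfolding query_true_iff by blast
    then obtain y where y: "(R, restrict (w(Y := y)) X) \<in> W" unfolding R' upd by blast
    have "(P, restrict (w(Y := y)) Z) \<in> W" if "(P, Z) \<in> q" for P Z
    proof (cases "(P, Z) = (R, X)")
      case False
      then have "Y \<notin> Z" using e(3) that by blast
      then have "restrict (w(Y := y)) Z = restrict w Z" by (auto simp: restrict_def)
      moreover have "P \<noteq> R'" using False that assms(2) by force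
      ultimately show ?thesis using w(2)[of P Z] False that P by simp
    qed (use y in simp)
    then show "query_true q W" unfolding query_true_iff by blast
  }
qed

text \<open>Atoms over the same variables are tested at the same restriction of \<open>w\<close>, so
  the equivalence holds for each \<open>w\<close> separately.\<close>

lemma query_true_merge:
  assumes "mergeable q R1 R2 X" "R' \<notin> fst ` (q - {(R1, X), (R2, X)})"
    and R': "\<And>x. (R', x) \<in> W' \<longleftrightarrow> (R1, x) \<in> W \<and> (R2, x) \<in> W"
    and P: "\<And>P x. P \<noteq> R' \<Longrightarrow> (P, x) \<in> W' \<longleftrightarrow> (P, x) \<in> W"
  shows "query_true (insert (R', X) (q - {(R1, X), (R2, X)})) W' \<longleftrightarrow> query_true q W"
proof -
  have "(P, x) \<in> W' \<longleftrightarrow> (P, x) \<in> W" if "(P, Z) \<in> q - {(R1, X), (R2, X)}" for P Z x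
    using that assms(2) by (intro P) force
  then have "(\<forall>(P, Z)\<in>insert (R', X) (q - {(R1, X), (R2, X)}). (P, restrict w Z) \<in> W') \<longleftrightarrow>
      (\<forall>(P, Z)\<in>q. (P, restrict w Z) \<in> W)" for w
    using assms(1) R' unfolding mergeable_def by blast
  then show ?thesis by (simp only: query_true_iff)
qed

text \<open>If \<open>at(Y)\<close> is minimal and contains two atoms, then any variable of one of them occurs in
  all atoms of \<open>at(Y)\<close>.\<close>

lemma hierarchical_progress:
  assumes "sjf_bcq q" "hierarchical q"
    and "\<nexists>R. q = {(R, {})}" "\<nexists>Y \<alpha>. eliminable q Y \<alpha>"
  shows "\<exists>R1 R2 X. mergeable q R1 R2 X"
proof -
  have fin: "finite q" and ne: "q \<noteq> {}" and inj: "inj_on fst q"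
    using assms(1) by (auto simp: sjf_bcq_def)
  obtain a b where ab: "a \<in> q" "b \<in> q" "a \<noteq> b" "snd a = snd b"
  proof (cases "vars q = {}")
    case True
    then have empty: "snd a = {}" if "a \<in> q" for a using that by (force simp: vars_def)
    obtain a where a: "a \<in> q" using ne by blast
    have "q \<noteq> {a}" using assms(3) empty[OF a] by (cases a) auto
    then obtain b where "b \<in> q" "b \<noteq> a" using a by blast
    then show ?thesis using that a empty by metis
  next
    case False
    obtain Y where Y: "Y \<in> vars q"
      "\<And>Z. Z \<in> vars q \<Longrightarrow> card (atoms_with q Y) \<le> card (atoms_with q Z)"
      using ex_has_least_nat[of "\<lambda>Y. Y \<in> vars q" _ "\<lambda>Y. card (atoms_with q Y)"] False by blast
    have fin': "finite (atoms_with q Z)" for Z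
      using fin by (rule rev_finite_subset) (auto simp: atoms_with_def)
    obtain a where a: "a \<in> atoms_with q Y" using Y(1) by (auto simp: vars_eq)
    have "atoms_with q Y \<noteq> {a}" using assms(4) unfolding eliminable_def by blast
    then obtain b where b: "b \<in> atoms_with q Y" "a \<noteq> b" using a by blast
    have sub: "snd c \<subseteq> snd d" if c: "c \<in> atoms_with q Y" and d: "d \<in> atoms_with q Y" for c d
    proof
      fix Z assume "Z \<in> snd c"
      then have cZ: "c \<in> atoms_with q Z" using c by (auto simp: atoms_with_def)
      then have Z: "Z \<in> vars q" by (auto simp: vars_eq)
      \<comment> \<open>The disjoint alternative is impossible, since \<open>c\<close> lies in both
        sets.\<close>
      then have "atoms_with q Z \<subseteq> atoms_with q Y \<or> atoms_with q Y \<subseteq> atoms_with q Z"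
        using assms(2) Y(1) c cZ by (auto simp: hierarchical_def)
      \<comment> \<open>In the case of the other inclusion, minimality of \<open>Y\<close> forces
        equality.\<close>
      then have "atoms_with q Y \<subseteq> atoms_with q Z"
        using card_seteq[OF fin'[of Y], of "atoms_with q Z"] Y(2)[OF Z] by auto
      then show "Z \<in> snd d" using d by (auto simp: atoms_with_def)
    qed
    show ?thesis
      using that[of a b] a b sub[of a b] sub[of b a] by (auto simp: atoms_with_def)
  qed
  then have "mergeable q (fst a) (fst b) (snd a)"
    using inj by (cases a; cases b) (auto simp: mergeable_def)
  then show ?thesis by blast
qed

text \<open>Termination measure; the summand \<open>1\<close> makes Rule 2 decrease it even for
  nullary atoms.\<close>

definition query_size :: "('r, 'v) query \<Rightarrow> nat" where
  "query_size q = (\<Sum>(R, X)\<in>q. 1 + card X)"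

lemma query_size_insert:
  "finite q \<Longrightarrow> R \<notin> fst ` q \<Longrightarrow> query_size (insert (R, X) q) = 1 + card X + query_size q"
  by (subst query_size_def, subst sum.insert) (force simp: query_size_def)+

lemma query_size_remove:
  assumes "finite q" "(R, X) \<in> q"
  shows "query_size q = 1 + card X + query_size (q - {(R, X)})"
  using sum.remove[OF assms, of "\<lambda>(R, X). 1 + card X"] by (simp add: query_size_def)

lemma card_less_query_size: "finite q \<Longrightarrow> (R, X) \<in> q \<Longrightarrow> card X < query_size q"
  using member_le_sum[of "(R, X)" q "\<lambda>(R, X). 1 + card X"] by (auto simp: query_size_def)

lemma query_size_eliminate:
  assumes "sjf_bcq q" "eliminable q Y (R, X)" "R' \<notin> fst ` (q - {(R, X)})"
  shows "query_size (insert (R', X - {Y}) (q - {(R, X)})) < query_size q"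
proof -
  note e = eliminableD[OF assms(2)]
  have fin: "finite q" "finite X" using assms(1) e(1) by (auto simp: sjf_bcq_def)
  have "query_size q = 1 + card X + query_size (q - {(R, X)})"
    using fin e(1) by (intro query_size_remove)
  moreover have "card (X - {Y}) < card X" using fin(2) e(2) by (rule card_Diff1_less)
  ultimately show ?thesis using fin assms(3) by (simp add: query_size_insert)
qed

lemma query_size_merge:
  assumes "sjf_bcq q" "mergeable q R1 R2 X" "R' \<notin> fst ` (q - {(R1, X), (R2, X)})"
  shows "query_size (insert (R', X) (q - {(R1, X), (R2, X)})) < query_size q"
proof -
  have fin: "finite q" using assms(1) by (auto simp: sjf_bcq_def)
  have "query_size q = 1 + card X + query_size (q - {(R1, X)})"
    using fin assms(2) by (intro query_size_remove) (auto simp: mergeable_def)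
  also have "query_size (q - {(R1, X)}) =
      1 + card X + query_size (q - {(R1, X)} - {(R2, X)})"
    using query_size_remove[of "q - {(R1, X)}" R2 X] fin assms(2)
    by (auto simp: mergeable_def)
  also have "q - {(R1, X)} - {(R2, X)} = q - {(R1, X), (R2, X)}" by auto
  finally show ?thesis using fin assms(3) by (simp add: query_size_insert)
qed

subsection \<open>Running time of the programs\<close>

lemma length_update_le: "length (AList.update k v T) \<le> Suc (length T)"
  by (induction T) auto

lemma ticks_drop_zeros: "ticks (drop_zeros K L) = 2 * length L + 1"
  by (induction L) (auto simp: is_zero_t_def)

text \<open>Per cell: one tick for fetching it, one for \<open>\<oplus>\<close>, and
  \<open>1 + card X\<close> each for projection, lookup and update.\<close>

lemma ticks_aggregate: "ticks (aggregate K X L T) = (5 + 3 * card X) * length L + 1"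
  by (induction L arbitrary: T) (auto simp: timed_ops_def algebra_simps)

lemma length_aggregate_le: "length (result (aggregate K X L T)) \<le> length L + length T"
proof (induction L arbitrary: T)
  case (Cons e L)
  obtain x a where e: "e = (x, a)" by (cases e)
  show ?case
    using order_trans[OF Cons.IH add_left_mono[OF length_update_le]]
    by (simp add: e timed_ops_def)
qed simp

text \<open>Each stored fact yields at most one table entry, which costs two more ticks in
  \<open>drop_zeros\<close>.\<close>

lemma ticks_rule1_prog_le: "ticks (rule1_prog K X L) \<le> (7 + 3 * card X) * length L + 2"
  using length_aggregate_le[of K X L "[]"]
  by (simp add: rule1_prog_def ticks_aggregate ticks_drop_zeros algebra_simps)

lemma ticks_build_table: "ticks (build_table X L T) = (2 + card X) * length L + 1"
  by (induction L arbitrary: T) (auto simp: timed_ops_def)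

lemma ticks_mult_all: "ticks (mult_all K X T L M) = (3 + card X) * length L + 1"
  by (induction L arbitrary: M) (auto simp: timed_ops_def)

lemma length_mult_all: "length (result (mult_all K X T L M)) = length L + length M"
  by (induction L arbitrary: M) (auto simp: timed_ops_def)

lemma ticks_mult_unmatched_le:
  "ticks (mult_unmatched K X T L M) \<le> (3 + card X) * length L + 1"
proof (induction L arbitrary: M)
  case (Cons e L)
  obtain x b where e: "e = (x, b)" by (cases e)
  show ?case using Cons.IH[of M] Cons.IH[of "(x, \<zero>\<^bsub>K\<^esub> \<otimes>\<^bsub>K\<^esub> b) # M"]
    by (simp add: e timed_ops_def)
qed simp

lemma length_mult_unmatched_le:
  "length (result (mult_unmatched K X T L M)) \<le> length L + length M"
proof (induction L arbitrary: M)
  case (Cons e L)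
  obtain x b where e: "e = (x, b)" by (cases e)
  show ?case using Cons.IH[of M] Cons.IH[of "(x, \<zero>\<^bsub>K\<^esub> \<otimes>\<^bsub>K\<^esub> b) # M"]
    by (simp add: e timed_ops_def)
qed simp

text \<open>A fact of either list costs \<open>2 + card X\<close> in \<open>build_table\<close>, at
  most \<open>3 + card X\<close> in its multiplication pass, and at most 2 in
  \<open>drop_zeros\<close>; the \<open>5\<close> counts the ends of the five passes.\<close>

lemma ticks_rule2_prog_le:
  "ticks (rule2_prog K X L1 L2) \<le> (7 + 2 * card X) * (length L1 + length L2) + 5"
proof -
  define T1 T2 where "T1 = result (build_table X L1 [])" and "T2 = result (build_table X L2 [])"
  define M where "M = result (mult_all K X T2 L1 [])"
  define M' where "M' = result (mult_unmatched K X T1 L2 M)"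
  have "length M = length L1" by (simp add: M_def length_mult_all)
  then have "length M' \<le> length L2 + length L1"
    using length_mult_unmatched_le[of K X T1 L2 M] by (simp add: M'_def)
  moreover have "ticks (rule2_prog K X L1 L2) = ticks (build_table X L1 []) +
      ticks (build_table X L2 []) + ticks (mult_all K X T2 L1 []) +
      ticks (mult_unmatched K X T1 L2 M) + ticks (drop_zeros K M')"
    by (simp add: rule2_prog_def T1_def T2_def M_def M'_def)
  ultimately show ?thesis
    using ticks_mult_unmatched_le[of K X T1 L2 M]
    by (simp add: ticks_build_table ticks_mult_all ticks_drop_zeros algebra_simps)
qed

subsection \<open>Intermediate instances and possible worlds\<close>

definition support :: "('r, 'v) query \<Rightarrow> ('r, 'v, 'd, real) adb \<Rightarrow> ('r, 'v, 'd) fact set" where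
  "support q A = {f \<in> facts q. A (fst f) (snd f) \<noteq> 0}"

text \<open>A fact \<open>f\<close> of the current query holds in exactly those worlds \<open>W \<subseteq> D\<close> that belong to
  \<open>E f\<close>, and \<open>S f\<close> is the set of original facts that \<open>f\<close> has been computed from.\<close>

definition represents :: "'f set \<Rightarrow> ('f \<Rightarrow> real) \<Rightarrow> ('r, 'v) query \<Rightarrow> ('r, 'v, 'd, real) adb \<Rightarrow>
    (('r, 'v, 'd) fact \<Rightarrow> 'f set) \<Rightarrow> (('r, 'v, 'd) fact \<Rightarrow> 'f set set) \<Rightarrow> bool" where
  "represents D p q A S E \<longleftrightarrow> disjoint_family_on S (facts q) \<and>
     (\<forall>f\<in>facts q. determined_by (S f) (E f) \<and> world_prob D p (E f) = A (fst f) (snd f))"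

text \<open>The cardinality bound keeps each iteration linear in \<open>card D\<close>; the last
  conjunct identifies the final event with the truth of \<open>Q\<close>. Annotations of facts of
  \<open>q\<close> lie between 0 and 1 because they are probabilities.\<close>

definition hea_invariant :: "('r, 'v) query \<Rightarrow> ('r, 'v, 'd) fact set \<Rightarrow>
    (('r, 'v, 'd) fact \<Rightarrow> real) \<Rightarrow> ('r, 'v) query \<Rightarrow> ('r, 'v, 'd, real) adb \<Rightarrow> bool" where
  "hea_invariant Q D p q A \<longleftrightarrow> sjf_bcq q \<and> hierarchical q \<and>
     finite (support q A) \<and> card (support q A) \<le> card D \<and>
     (\<exists>S E. represents D p q A S E \<and> (\<forall>W. query_true q {f. W \<in> E f} \<longleftrightarrow> query_true Q W))"

lemma hea_invariant_initial:
  assumes "sjf_bcq Q" "hierarchical Q" "prob_db Q D p"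
  shows "hea_invariant Q D p Q (prob_annotation D p)"
proof -
  have D: "finite D" "\<And>f. f \<in> D \<Longrightarrow> 0 \<le> p f \<and> p f \<le> 1"
    using assms(3) by (auto simp: prob_db_def db_instance_def)
  have "support Q (prob_annotation D p) \<subseteq> D"
    by (auto simp: support_def prob_annotation_def split: if_splits)
  \<comment> \<open>Initially the event of a fact is its own presence.\<close>
  moreover have "represents D p Q (prob_annotation D p) (\<lambda>f. {f}) (\<lambda>f. {W. f \<in> W})"
    using D by (auto simp: represents_def disjoint_family_on_def determined_by_def
        prob_annotation_def world_prob_member)
  ultimately show ?thesis
    using assms(1,2) D(1) unfolding hea_invariant_def
    by (intro conjI exI[of _ "\<lambda>f. {f}"] exI[of _ "\<lambda>f. {W. f \<in> W}"])
      (auto intro: finite_subset card_mono)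
qed

text \<open>\<open>G f\<close> are the facts that the new fact \<open>f\<close> is computed from.\<close>

lemma hea_invariant_transfer:
  assumes inv: "finite (support q A)" "card (support q A) \<le> card D" "represents D p q A S E"
      "\<And>W. query_true q {f. W \<in> E f} \<longleftrightarrow> query_true Q W"
    and q': "sjf_bcq q'" "hierarchical q'"
    and G: "\<And>f. f \<in> facts q' \<Longrightarrow> G f \<subseteq> facts q" "disjoint_family_on G (facts q')"
    and supp: "\<And>f. f \<in> support q' A' \<Longrightarrow> G f \<inter> support q A \<noteq> {}"
    and E': "\<And>f. f \<in> facts q' \<Longrightarrow> determined_by (\<Union>g\<in>G f. S g) (E' f)"
      "\<And>f. f \<in> facts q' \<Longrightarrow> world_prob D p (E' f) = A' (fst f) (snd f)"
    and true: "\<And>W. query_true q' {f. W \<in> E' f} \<longleftrightarrow> query_true q {f. W \<in> E f}"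
  shows "hea_invariant Q D p q' A'"
proof -
  \<comment> \<open>Choosing a nonzero old fact from the group of each nonzero new one is injective,
    as groups are disjoint; so the support does not grow.\<close>
  have "\<forall>f\<in>support q' A'. \<exists>g. g \<in> G f \<inter> support q A" using supp by blast
  then obtain h where h: "\<And>f. f \<in> support q' A' \<Longrightarrow> h f \<in> G f \<inter> support q A"
    using bchoice by metis
  have "inj_on h (support q' A')"
    using h G(2) by (fastforce simp: inj_on_def disjoint_family_on_def support_def)
  moreover have "h ` support q' A' \<subseteq> support q A" using h by auto
  ultimately have "finite (support q' A')" "card (support q' A') \<le> card (support q A)"
    using inv(1) by (auto intro: inj_on_finite card_inj_on_le)
  moreover have "(\<Union>g\<in>G f. S g) \<inter> (\<Union>g\<in>G f'. S g) = {}"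
    if f: "f \<in> facts q'" "f' \<in> facts q'" "f \<noteq> f'" for f f'
  proof -
    have "S g \<inter> S g' = {}" if "g \<in> G f" "g' \<in> G f'" for g g'
    proof -
      have "G f \<inter> G f' = {}" using f G(2) by (simp add: disjoint_family_on_def)
      then have "g \<noteq> g'" using that by blast
      moreover have "g \<in> facts q" "g' \<in> facts q" using that f(1,2) G(1) by blast+
      ultimately show ?thesis using inv(3) by (simp add: represents_def disjoint_family_on_def)
    qed
    then show ?thesis by blast
  qed
  then have "represents D p q' A' (\<lambda>f. \<Union>g\<in>G f. S g) E'"
    using E' by (simp add: represents_def disjoint_family_on_def)
  moreover have "\<forall>W. query_true q' {f. W \<in> E' f} \<longleftrightarrow> query_true Q W"
    by (simp only: true inv(4) simp_thms)
  ultimately show ?thesis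
    using inv(2) q' unfolding hea_invariant_def by (meson order_trans)
qed

section \<open>Facts and tuples of a rewritten query\<close>

lemma facts_insertE:
  assumes "f \<in> facts (insert (R', X') q0)"
  obtains "fst f = R'" "snd f \<in> tuples X'" | "f \<in> facts q0"
  using assms by (auto simp: facts_def)

lemma fst_facts: "f \<in> facts q \<Longrightarrow> fst f \<in> fst ` q"
  by (force simp: facts_def)

lemma facts_mono: "q0 \<subseteq> q \<Longrightarrow> facts q0 \<subseteq> facts q"
  by (auto simp: facts_def)

text \<open>Since \<open>q\<close> is self-join-free, no fact of the remaining atoms carries the
  symbol of a removed one.\<close>

lemma facts_Diff_neq:
  assumes "sjf_bcq q" "a \<in> q" "a \<notin> q0" "q0 \<subseteq> q" "f \<in> facts q0"
  shows "fst f \<noteq> fst a"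
proof
  assume "fst f = fst a"
  then obtain b where "b \<in> q0" "fst b = fst a" using fst_facts[OF assms(5)] by auto
  then show False using assms(1-4) by (auto simp: sjf_bcq_def dest: inj_onD)
qed

lemma fun_upd_in_tuples: "x \<in> tuples (X - {Y}) \<Longrightarrow> Y \<in> X \<Longrightarrow> x(Y := y) \<in> tuples X"
  by (auto simp: tuples_def PiE_iff extensional_def)

lemma tuples_fun_upd_eqD:
  assumes "x(Y := y) = x'(Y := y')" "x \<in> tuples (X - {Y})" "x' \<in> tuples (X - {Y})"
  shows "x = x'"
proof
  fix Z
  show "x Z = x' Z"
    using assms(2,3) fun_cong[OF assms(1), of Z]
    by (cases "Z = Y") (auto simp: tuples_def PiE_iff extensional_def)
qed

text \<open>The group of a new fact \<open>R'(x)\<close> consists of all \<open>R(x,y)\<close>, and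
  its event is the union of theirs; independence within the group yields the
  \<open>\<oplus>\<close>-sum.\<close>

lemma hea_invariant_eliminate:
  fixes A :: "('r, 'v, 'd, real) adb"
  assumes D: "finite D" and inv: "hea_invariant Q D p q A"
    and el: "eliminable q Y (R, X)" and R': "R' \<notin> fst ` (q - {(R, X)})"
  shows "hea_invariant Q D p (insert (R', X - {Y}) (q - {(R, X)}))
    (A(R' := rule1_rel prob_monoid Y (A R)))" (is "hea_invariant _ _ _ ?q ?A")
proof -
  note e = eliminableD[OF el]
  obtain S E where q: "sjf_bcq q" "hierarchical q"
      "finite (support q A)" "card (support q A) \<le> card D"
    and rep: "represents D p q A S E"
    and true: "\<And>W. query_true q {f. W \<in> E f} \<longleftrightarrow> query_true Q W"
    using inv unfolding hea_invariant_def by blast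
  define G where "G f = (if fst f = R' then range (\<lambda>y. (R, (snd f)(Y := y))) else {f})"
    for f :: "('r, 'v, 'd) fact"
  define E' where "E' f = (\<Union>g\<in>G f. E g)" for f
  \<comment> \<open>\<open>R'\<close> may equal \<open>R\<close>; excluding both symbols separates
    the kept facts from the new ones and from their groups.\<close>
  have facts_q': "fst f = R' \<and> snd f \<in> tuples (X - {Y}) \<or>
      fst f \<noteq> R' \<and> fst f \<noteq> R \<and> f \<in> facts q" if "f \<in> facts ?q" for f :: "('r, 'v, 'd) fact"
    using that
  proof (cases rule: facts_insertE)
    case 2
    then show ?thesis
      using facts_Diff_neq[OF q(1) e(1), of "q - {(R, X)}" f] R' fst_facts[OF 2]
        facts_mono[of "q - {(R, X)}" q] by auto
  qed auto
  have upd: "(R, x(Y := y)) \<in> facts q" if "x \<in> tuples (X - {Y})" for x :: "('v, 'd) tuple" and y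
    using fun_upd_in_tuples[OF that e(2)] e(1) by (auto simp: facts_def)
  have rel: "world_prob D p (\<Union>y. E (R, x(Y := y))) = rule1_rel prob_monoid Y (A R) x"
    if x: "x \<in> tuples (X - {Y})" for x
  proof -
    have P: "world_prob D p (E (R, x(Y := y))) = A R (x(Y := y))" for y
      using rep upd[OF x] by (auto simp: represents_def)
    have fin: "finite {y. A R (x(Y := y)) \<noteq> 0}"
    proof (rule inj_on_finite)
      show "inj_on (\<lambda>y. (R, x(Y := y))) {y. A R (x(Y := y)) \<noteq> 0}"
        by (auto simp: inj_on_def dest: fun_upd_eqD)
    qed (use upd[OF x] q(3) in \<open>auto simp: support_def\<close>)
    have "world_prob D p (\<Union>y. E (R, x(Y := y))) =
        1 - (\<Prod>y | A R (x(Y := y)) \<noteq> 0. 1 - A R (x(Y := y)))"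
    proof (subst world_prob_UN[OF D, where S = "\<lambda>y. S (R, x(Y := y))"])
      show "disjoint_family_on (\<lambda>y. S (R, x(Y := y))) UNIV"
        unfolding disjoint_family_on_def
      proof (intro ballI impI)
        fix y y' :: 'd assume "y \<noteq> y'"
        then have "(R, x(Y := y)) \<noteq> (R, x(Y := y'))" by (auto dest: fun_upd_eqD)
        then show "S (R, x(Y := y)) \<inter> S (R, x(Y := y')) = {}"
          using rep upd[OF x] unfolding represents_def disjoint_family_on_def by blast
      qed
    qed (use fin rep upd[OF x] in \<open>auto simp: P represents_def\<close>)
    \<comment> \<open>The annotations are probabilities, which supplies the bounds that
      \<open>finsum_prob_monoid\<close> requires.\<close>
    also have "\<dots> = rule1_rel prob_monoid Y (A R) x"
      unfolding rule1_rel_def zero_prob_monoid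
      by (rule finsum_prob_monoid[symmetric, OF fin]) (auto simp: P[symmetric])
    finally show ?thesis .
  qed
  show ?thesis
  proof (rule hea_invariant_transfer[OF q(3,4) rep true, where G = G and E' = E'])
    show "sjf_bcq ?q" using q(1) e(1) R' by (intro sjf_bcq_insert[OF q(1)]) (auto simp: sjf_bcq_def)
    show "hierarchical ?q" by (rule hierarchical_eliminate[OF q(2) el R'])
    show sub: "G f \<subseteq> facts q" if "f \<in> facts ?q" for f
      using facts_q'[OF that] upd by (auto simp: G_def)
    show "disjoint_family_on G (facts ?q)"
      unfolding disjoint_family_on_def
    proof (intro ballI impI)
      fix f f' :: "('r, 'v, 'd) fact" assume f: "f \<in> facts ?q" "f' \<in> facts ?q" "f \<noteq> f'"
      show "G f \<inter> G f' = {}"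
        using facts_q'[OF f(1)] facts_q'[OF f(2)] f(3)
        by (cases f; cases f') (auto simp: G_def dest: tuples_fun_upd_eqD)
    qed
    show "G f \<inter> support q A \<noteq> {}" if "f \<in> support ?q ?A" for f
    proof -
      have f: "f \<in> facts ?q" "?A (fst f) (snd f) \<noteq> 0" using that by (auto simp: support_def)
      show ?thesis
      proof (cases "fst f = R'")
        case True
        then have "rule1_rel prob_monoid Y (A R) (snd f) \<noteq> 0" using f(2) by simp
        \<comment> \<open>Otherwise the sum would be empty, hence \<open>0\<close>.\<close>
        then have "{y. A R ((snd f)(Y := y)) \<noteq> 0} \<noteq> {}"
          unfolding rule1_rel_def zero_prob_monoid
          by (metis prob_monoid.finsum_empty zero_prob_monoid)
        then show ?thesis
          using True facts_q'[OF f(1)] upd by (fastforce simp: G_def support_def)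
      next
        case False
        then show ?thesis using f(2) facts_q'[OF f(1)] by (auto simp: G_def support_def)
      qed
    qed
    show "determined_by (\<Union>g\<in>G f. S g) (E' f)" if "f \<in> facts ?q" for f
      unfolding E'_def using rep sub[OF that]
      by (intro determined_by_UN) (auto simp: represents_def)
    show "world_prob D p (E' f) = ?A (fst f) (snd f)" if "f \<in> facts ?q" for f
      using facts_q'[OF that] rel rep by (auto simp: E'_def G_def represents_def)
    show "query_true ?q {f. W \<in> E' f} \<longleftrightarrow> query_true q {f. W \<in> E f}" for W
      by (rule query_true_eliminate[OF el R']) (auto simp: E'_def G_def)
  qed
qed

text \<open>The group of \<open>R'(x)\<close> is the pair \<open>R1(x)\<close>,
  \<open>R2(x)\<close>, whose events depend on disjoint sets of input facts; so the product is the
  probability of their intersection.\<close>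

lemma hea_invariant_merge:
  fixes A :: "('r, 'v, 'd, real) adb"
  assumes D: "finite D" and inv: "hea_invariant Q D p q A"
    and mg: "mergeable q R1 R2 X" and R': "R' \<notin> fst ` (q - {(R1, X), (R2, X)})"
  shows "hea_invariant Q D p (insert (R', X) (q - {(R1, X), (R2, X)}))
    (A(R' := rule2_rel prob_monoid (A R1) (A R2)))" (is "hea_invariant _ _ _ ?q ?A")
proof -
  have m: "R1 \<noteq> R2" "(R1, X) \<in> q" "(R2, X) \<in> q" using mg by (auto simp: mergeable_def)
  obtain S E where q: "sjf_bcq q" "hierarchical q"
      "finite (support q A)" "card (support q A) \<le> card D"
    and rep: "represents D p q A S E"
    and true: "\<And>W. query_true q {f. W \<in> E f} \<longleftrightarrow> query_true Q W"
    using inv unfolding hea_invariant_def by blast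
  define G where "G f = (if fst f = R' then {(R1, snd f), (R2, snd f)} else {f})"
    for f :: "('r, 'v, 'd) fact"
  define E' where "E' f = (\<Inter>g\<in>G f. E g)" for f
  have facts_q': "fst f = R' \<and> snd f \<in> tuples X \<or>
      fst f \<noteq> R' \<and> fst f \<noteq> R1 \<and> fst f \<noteq> R2 \<and> f \<in> facts q"
    if "f \<in> facts ?q" for f :: "('r, 'v, 'd) fact"
    using that
  proof (cases rule: facts_insertE)
    case 2
    then show ?thesis
      using facts_Diff_neq[OF q(1) m(2), of "q - {(R1, X), (R2, X)}" f]
        facts_Diff_neq[OF q(1) m(3), of "q - {(R1, X), (R2, X)}" f]
        R' fst_facts[OF 2] facts_mono[of "q - {(R1, X), (R2, X)}" q] by auto
  qed auto
  have facts_q: "(R1, x) \<in> facts q" "(R2, x) \<in> facts q" if "x \<in> tuples X"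
    for x :: "('v, 'd) tuple"
    using that m by (auto simp: facts_def)
  have rel: "world_prob D p (E (R1, x) \<inter> E (R2, x)) = A R1 x * A R2 x"
    if x: "x \<in> tuples X" for x
  proof -
    have "S (R1, x) \<inter> S (R2, x) = {}"
      using rep facts_q[OF x] m(1) unfolding represents_def disjoint_family_on_def by blast
    then have "world_prob D p (E (R1, x) \<inter> E (R2, x)) =
        world_prob D p (E (R1, x)) * world_prob D p (E (R2, x))"
      using rep facts_q[OF x] by (intro world_prob_Int[OF D]) (auto simp: represents_def)
    then show ?thesis using rep facts_q[OF x] by (auto simp: represents_def)
  qed
  show ?thesis
  proof (rule hea_invariant_transfer[OF q(3,4) rep true, where G = G and E' = E'])
    show "sjf_bcq ?q" using q(1) m R' by (intro sjf_bcq_insert[OF q(1)]) (auto simp: sjf_bcq_def)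
    show "hierarchical ?q" by (rule hierarchical_merge[OF q(2) mg R'])
    show sub: "G f \<subseteq> facts q" if "f \<in> facts ?q" for f
      using facts_q'[OF that] facts_q by (auto simp: G_def)
    show "disjoint_family_on G (facts ?q)"
      unfolding disjoint_family_on_def
    proof (intro ballI impI)
      fix f f' :: "('r, 'v, 'd) fact" assume f: "f \<in> facts ?q" "f' \<in> facts ?q" "f \<noteq> f'"
      show "G f \<inter> G f' = {}"
        using facts_q'[OF f(1)] facts_q'[OF f(2)] f(3) by (cases f; cases f') (auto simp: G_def)
    qed
    show "G f \<inter> support q A \<noteq> {}" if "f \<in> support ?q ?A" for f
    proof -
      have "f \<in> facts ?q" "?A (fst f) (snd f) \<noteq> 0" using that by (auto simp: support_def)
      then show ?thesis
        using facts_q'[of f] facts_q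
        by (auto simp: G_def support_def rule2_rel_def prob_monoid_def split: if_splits)
    qed
    show "determined_by (\<Union>g\<in>G f. S g) (E' f)" if "f \<in> facts ?q" for f
      unfolding E'_def using rep sub[OF that]
      by (intro determined_by_INT) (auto simp: represents_def)
    show "world_prob D p (E' f) = ?A (fst f) (snd f)" if "f \<in> facts ?q" for f
      using facts_q'[OF that] rel rep
      by (auto simp: E'_def G_def represents_def rule2_rel_def prob_monoid_def)
    show "query_true ?q {f. W \<in> E' f} \<longleftrightarrow> query_true q {f. W \<in> E f}" for W
      by (rule query_true_merge[OF mg R']) (auto simp: E'_def G_def)
  qed
qed

text \<open>The empty tuple gives the only fact, and by the invariant its event consists of the
  worlds in which \<open>Q\<close> is true.\<close>

lemma hea_invariant_output:
  assumes "hea_invariant Q D p {(R, {})} A"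
  shows "A R (\<lambda>_. undefined) = query_prob Q D p"
proof -
  obtain S E where rep: "represents D p {(R, {})} A S E"
    and true: "\<And>W. query_true {(R, {})} {f. W \<in> E f} \<longleftrightarrow> query_true Q W"
    using assms unfolding hea_invariant_def by blast
  have "(R, \<lambda>_. undefined) \<in> facts {(R, {})}" by (simp add: facts_def tuples_def)
  then have "A R (\<lambda>_. undefined) = world_prob D p (E (R, \<lambda>_. undefined))"
    using rep by (auto simp: represents_def)
  moreover have "query_true Q W \<longleftrightarrow> W \<in> E (R, \<lambda>_. undefined)" for W
    unfolding true[symmetric] by (simp add: query_true_iff restrict_def)
  ultimately show ?thesis by (simp add: query_prob_def)
qed

subsection \<open>Executions\<close>

text \<open>Tagging with the symbol embeds a list of stored facts into the support, which bounds its
  length.\<close>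

lemma stores_support:
  assumes "stores prob_monoid X (A R) L" "(R, X) \<in> q"
  shows "set (map (Pair R \<circ> fst) L) \<subseteq> support q A" "distinct (map (Pair R \<circ> fst) L)"
proof -
  show "set (map (Pair R \<circ> fst) L) \<subseteq> support q A"
    using assms by (auto simp: stores_def support_def facts_def)
  have "distinct (map (Pair R) (map fst L))"
    using assms by (subst distinct_map) (auto simp: stores_def inj_on_def)
  then show "distinct (map (Pair R \<circ> fst) L)" by simp
qed

lemma stores_exists:
  fixes A :: "('r, 'v, 'd, real) adb"
  assumes "finite (support q A)" "(R, X) \<in> q"
  shows "\<exists>L. stores prob_monoid X (A R) L"
proof -
  have "finite {x \<in> tuples X. A R x \<noteq> 0}"
  proof (rule inj_on_finite)
    show "inj_on (Pair R) {x \<in> tuples X. A R x \<noteq> 0}" by (simp add: inj_on_def)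
  qed (use assms in \<open>auto simp: support_def facts_def\<close>)
  then obtain xs where "set xs = {x \<in> tuples X. A R x \<noteq> 0}" "distinct xs"
    using finite_distinct_list by blast
  then have "stores prob_monoid X (A R) (map (\<lambda>x. (x, A R x)) xs)"
    by (auto simp: stores_def comp_def)
  then show ?thesis ..
qed

text \<open>The square pays for selecting a rule; \<open>n + 1\<close> instead of \<open>n\<close>
  absorbs the additive constants of the programs, which are at most \<open>5\<close>.\<close>

definition step_bound :: "nat \<Rightarrow> nat \<Rightarrow> nat" where
  "step_bound n s = s\<^sup>2 + (7 + 3 * s) * (n + 1)"

lemma rule_ticks_le_step_bound:
  assumes "l \<le> n" "c < s" "t \<le> (7 + 3 * c) * l + 5"
  shows "s\<^sup>2 + t \<le> step_bound n s"
proof -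
  have "(7 + 3 * c) * l \<le> (7 + 3 * s) * n" using assms(1,2) by (intro mult_mono) auto
  then show ?thesis using assms(3) by (simp add: step_bound_def)
qed

lemma step_bound_mono: "s \<le> s' \<Longrightarrow> step_bound n s \<le> step_bound n s'"
  unfolding step_bound_def by (intro add_mono mult_mono power_mono) auto

text \<open>Final configurations have size \<open>0\<close>, so that halting decreases the size
  too.\<close>

fun config_size :: "('r, 'v, 'd, 'k) config \<Rightarrow> nat" where
  "config_size (Running q A) = query_size q"
| "config_size (Output k) = 0"
| "config_size Not_Hierarchical = 0"

fun config_invariant :: "('r, 'v) query \<Rightarrow> ('r, 'v, 'd) fact set \<Rightarrow>
    (('r, 'v, 'd) fact \<Rightarrow> real) \<Rightarrow> ('r, 'v, 'd, real) config \<Rightarrow> bool" where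
  "config_invariant Q D p (Running q A) = hea_invariant Q D p q A"
| "config_invariant Q D p (Output k) = (k = query_prob Q D p)"
| "config_invariant Q D p Not_Hierarchical = False"

lemma selection_cost_eq: "selection_cost q = (query_size q)\<^sup>2"
  by (simp add: selection_cost_def query_size_def)

lemma hea_step_invariant:
  fixes c c' :: "('r, 'v, 'd, real) config"
  assumes "hea_step prob_monoid c t c'" "finite D" "config_invariant Q D p c"
  shows "config_invariant Q D p c' \<and> config_size c' < config_size c \<and>
    t \<le> step_bound (card D) (config_size c)"
  using assms(1,3)
proof cases
  case (halt q R A)
  have "query_size q = 1" using halt(4) by (simp add: query_size_def)
  then show ?thesis
    using halt assms(3) hea_invariant_output[of Q D p R A]
    by (simp add: selection_cost_eq step_bound_def)
next
  case (rule1 q Y R X q' R' A L)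
  have inv: "hea_invariant Q D p q A" using assms(3) rule1 by simp
  then have q: "sjf_bcq q" "finite q" "finite (support q A)" "card (support q A) \<le> card D"
    by (auto simp: hea_invariant_def sjf_bcq_def)
  note e = eliminableD[OF rule1(5)]
  have R': "R' \<notin> fst ` (q - {(R, X)})" using rule1 by simp
  have "length L = card (set (map (Pair R \<circ> fst) L))"
    using distinct_card[OF stores_support(2)[of X A R _ q, OF rule1(8) e(1)]] by simp
  also have "\<dots> \<le> card D"
    using card_mono[OF q(3) stores_support(1)[of X A R _ q, OF rule1(8) e(1)]] q(4) by simp
  finally have len: "length L \<le> card D" .
  have c: "card (X - {Y}) < query_size q"
    using card_less_query_size[OF q(2) e(1)] card_Diff1_le[of X Y] by simp
  have "ticks (rule1_prog prob_monoid (X - {Y}) L) \<le> (7 + 3 * card (X - {Y})) * length L + 5"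
    using ticks_rule1_prog_le[of prob_monoid "X - {Y}" L] by simp
  from rule_ticks_le_step_bound[OF len c this] show ?thesis
    using rule1 hea_invariant_eliminate[OF assms(2) inv rule1(5) R']
      query_size_eliminate[OF q(1) rule1(5) R']
    by (simp add: selection_cost_eq)
next
  case (rule2 q R1 R2 X q' R' A L1 L2)
  have inv: "hea_invariant Q D p q A" using assms(3) rule2 by simp
  then have q: "sjf_bcq q" "finite q" "finite (support q A)" "card (support q A) \<le> card D"
    by (auto simp: hea_invariant_def sjf_bcq_def)
  have m: "R1 \<noteq> R2" "(R1, X) \<in> q" "(R2, X) \<in> q" using rule2 by (auto simp: mergeable_def)
  have R': "R' \<notin> fst ` (q - {(R1, X), (R2, X)})" using rule2 by simp
  \<comment> \<open>Tagging with distinct symbols keeps the two lists disjoint, so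
    \<open>card D\<close> bounds their total length.\<close>
  define F where "F = map (Pair R1 \<circ> fst) L1 @ map (Pair R2 \<circ> fst) L2"
  have "distinct F"
    using stores_support(2)[of X A R1 _ q, OF rule2(9) m(2)]
      stores_support(2)[of X A R2 _ q, OF rule2(10) m(3)] m(1)
    by (auto simp: F_def)
  then have "length L1 + length L2 = card (set F)" by (simp add: distinct_card) (simp add: F_def)
  also have "set F \<subseteq> support q A"
    using stores_support(1)[of X A R1 _ q, OF rule2(9) m(2)]
      stores_support(1)[of X A R2 _ q, OF rule2(10) m(3)]
    by (simp add: F_def)
  then have "card (set F) \<le> card D" using card_mono[OF q(3)] q(4) by (meson order_trans)
  finally have len: "length L1 + length L2 \<le> card D" .
  have "ticks (rule2_prog prob_monoid X L1 L2) \<le> (7 + 3 * card X) * (length L1 + length L2) + 5"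
    by (rule order_trans[OF ticks_rule2_prog_le]) (intro add_mono mult_mono, auto)
  from rule_ticks_le_step_bound[OF len card_less_query_size[OF q(2) m(2)] this] show ?thesis
    using rule2 hea_invariant_merge[OF assms(2) inv rule2(6) R']
      query_size_merge[OF q(1) rule2(6) R']
    by (simp add: selection_cost_eq)
next
  case (not_hierarchical q A)
  \<comment> \<open>This case contradicts \<open>hierarchical_progress\<close>.\<close>
  then show ?thesis
    using assms(3) hierarchical_progress[of q] by (auto simp: hea_invariant_def)
qed

lemma hea_progress:
  assumes "config_invariant Q D p (Running q A)"
  shows "\<exists>t c'. hea_step prob_monoid (Running q A) t c'"
proof -
  have q: "sjf_bcq q" "hierarchical q" "finite (support q A)"
    using assms by (auto simp: hea_invariant_def)
  then have inj: "inj_on fst q" by (simp add: sjf_bcq_def)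
  consider (halt) R where "q = {(R, {})}"
    | (rule1) Y R X where "\<nexists>R. q = {(R, {})}" "eliminable q Y (R, X)"
    | (rule2) R1 R2 X where "\<nexists>R. q = {(R, {})}" "\<nexists>Y \<alpha>. eliminable q Y \<alpha>" "mergeable q R1 R2 X"
    using hierarchical_progress[OF q(1,2)] by (metis surj_pair)
  then show ?thesis
  proof cases
    case halt
    then show ?thesis by (blast intro: hea_step.halt)
  next
    case rule1
    note e = eliminableD[OF rule1(2)]
    obtain L where "stores prob_monoid X (A R) L" using stores_exists[OF q(3) e(1)] by blast
    \<comment> \<open>The symbol of the removed atom itself can name the new one.\<close>
    moreover have "R \<notin> fst ` (q - {(R, X)})" using inj e(1) by (force simp: inj_on_def)
    ultimately show ?thesis using hea_step.rule1[OF rule1 HOL.refl] by blast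
  next
    case rule2
    then have m: "(R1, X) \<in> q" "(R2, X) \<in> q" by (auto simp: mergeable_def)
    obtain L1 L2 where "stores prob_monoid X (A R1) L1" "stores prob_monoid X (A R2) L2"
      using stores_exists[OF q(3)] m by meson
    moreover have "R1 \<notin> fst ` (q - {(R1, X), (R2, X)})" using inj m(1) by (force simp: inj_on_def)
    ultimately show ?thesis using hea_step.rule2[OF rule2 HOL.refl] by blast
  qed
qed

text \<open>The size drops in each step, so there are at most \<open>config_size c\<close> steps,
  each within the bound for the initial size.\<close>

lemma hea_exec_invariant:
  assumes "hea_exec prob_monoid c t c'" "finite D" "config_invariant Q D p c"
  shows "config_invariant Q D p c' \<and> t \<le> config_size c * step_bound (card D) (config_size c)"
  using assms(1,3)
proof (induction rule: hea_exec.induct)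
  case (step c t c' u c'')
  note s = hea_step_invariant[OF step.hyps(1) assms(2) step.prems]
  let ?B = "\<lambda>c. step_bound (card D) (config_size c)"
  have IH: "config_invariant Q D p c''" "u \<le> config_size c' * ?B c'"
    using step.IH s by auto
  have "t + u \<le> ?B c + config_size c' * ?B c'" using s IH(2) by simp
  also have "\<dots> \<le> ?B c + config_size c' * ?B c"
    using s by (intro add_left_mono mult_left_mono step_bound_mono) auto
  also have "\<dots> = Suc (config_size c') * ?B c" by simp
  also have "\<dots> \<le> config_size c * ?B c" using s by (intro mult_right_mono) auto
  finally show ?case using IH(1) by simp
qed simp

lemma hea_terminates:
  assumes "finite D" "config_invariant Q D p (s 0)"
  shows "\<not> (\<forall>i. \<exists>t. hea_step prob_monoid (s i) t (s (Suc i)))"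
proof
  assume *: "\<forall>i. \<exists>t. hea_step prob_monoid (s i) t (s (Suc i))"
  have inv: "config_invariant Q D p (s i)" for i
    using assms * hea_step_invariant by (induction i) blast+
  have "config_size (s (Suc i)) < config_size (s i)" for i
    using hea_step_invariant[OF _ assms(1) inv] * by blast
  then show False using wf_no_infinite_down_chainE[OF wf_measure[of config_size], of s] by auto
qed

theorem theorem5p8:
  fixes Q :: "('r, 'v) query"
  assumes "sjf_bcq Q" and "hierarchical Q"
  shows "\<exists>C::nat. \<forall>(D :: ('r, 'v, 'd::{countable, infinite}) fact set) p.
    prob_db Q D p \<longrightarrow>
    hea_outputs_within prob_monoid (Running Q (prob_annotation D p))
      (query_prob Q D p) (C * max 1 (card D))"
proof (intro exI allI impI)
  fix D :: "('r, 'v, 'd) fact set" and p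
  assume db: "prob_db Q D p"
  let ?s = "query_size Q" and ?m = "max 1 (card D)"
  let ?c = "Running Q (prob_annotation D p)"
  have D: "finite D" using db by (auto simp: prob_db_def db_instance_def)
  have inv: "config_invariant Q D p ?c"
    using hea_invariant_initial[OF assms db] by simp
  \<comment> \<open>Here \<open>card D + 1 \<le> 2 * ?m\<close>; the remaining factor, times
    \<open>?s\<close>, depends on \<open>Q\<close> alone and becomes \<open>C\<close>.\<close>
  have "step_bound (card D) ?s \<le> ?s\<^sup>2 * ?m + (7 + 3 * ?s) * (2 * ?m)"
    unfolding step_bound_def by (intro add_mono mult_left_mono) auto
  also have "\<dots> = (?s\<^sup>2 + 2 * (7 + 3 * ?s)) * ?m" by (simp add: algebra_simps)
  finally have bound: "?s * step_bound (card D) ?s \<le> ?s * (?s\<^sup>2 + 2 * (7 + 3 * ?s)) * ?m"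
    by (simp only: mult.assoc mult_le_mono2)
  show "hea_outputs_within prob_monoid ?c (query_prob Q D p)
      (?s * (?s\<^sup>2 + 2 * (7 + 3 * ?s)) * ?m)"
    unfolding hea_outputs_within_def
  proof (intro conjI allI impI)
    show "\<nexists>s. s 0 = ?c \<and> (\<forall>i. \<exists>t. hea_step prob_monoid (s i) t (s (Suc i)))"
      using hea_terminates[OF D, of Q p] inv by metis
    fix t c' assume "hea_exec prob_monoid ?c t c'"
    then have c': "config_invariant Q D p c'" and "t \<le> ?s * step_bound (card D) ?s"
      using hea_exec_invariant[OF _ D inv] by auto
    then show "t \<le> ?s * (?s\<^sup>2 + 2 * (7 + 3 * ?s)) * ?m" using bound by linarith
    assume "\<nexists>u c''. hea_step prob_monoid c' u c''"
    \<comment> \<open>A running configuration can always step, and the invariant rules out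
      \<open>Not_Hierarchical\<close>.\<close>
    then show "c' = Output (query_prob Q D p)"
    proof (cases c')
      case (Running q A)
      then show ?thesis
        using c' hea_progress \<open>\<nexists>u c''. hea_step prob_monoid c' u c''\<close> by blast
    qed (use c' in auto)
  qed
qed

end
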